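(* Let $d\ge 1$, $\mathcal D=[0,1]^d$, let $\mathbf l=(l_1,\dots,l_k)$ be a decomposition vector of $d$, let $\boldsymbol\alpha=(\alpha_1,\dots,\alpha_k)$ with $0<\alpha_j<2$, and let $C>0$. Let $X\in\mathcal C^{\boldsymbol\alpha}_{\mathbf l}(\mathcal D,C)$ be a random field and let $I(X)=\int_{\mathcal D}X(\mathbf t)\,d\mathbf t$ be approximated by the stratified Monte Carlo quadrature $I_N(X,T_N)$, where $T_N$ is $cRS(h,\pi,\mathbf l)$, $\pi(N)=(n_1(N),\dots,n_k(N))$. Then $$\|I(X)-I_N(X,T_N)\|^2\le\frac CN\sum_{j=1}^k\frac{d_j}{n_j^{\alpha_j}}$$ for positive constants $d_1,\dots,d_k$ (not depending on $N$). Moreover, if $n_j\sim N^{\rho/\alpha_j}$, $j=1,\dots,k$, where $\rho:=\bigl(\sum_{i=1}^kl_i/\alpha_i\bigr)^{-1}$, then $$\|I(X)-I_N(X,T_N)\|^2=O\bigl(N^{-(1+\rho)}\bigr)\quad\text{as }N\to\infty.$$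
   Context: Norms. For a square-integrable random variable $\xi$, $\|\xi\|=(\mathrm E\,\xi^2)^{1/2}$; for a vector, $\|\cdot\|$ is the Euclidean norm. $a_N\sim b_N$ means $a_N/b_N\to1$. Decomposition. $\mathbf l=(l_1,\dots,l_k)$, $k\le d$, is a vector of positive integers with $\sum_j l_j=d$; $L_0=0$, $L_i=\sum_{j\le i}l_j$. For $\mathbf s\in\mathbb R^d$, $\mathbf s^j=(s_{L_{j-1}+1},\dots,s_{L_j})$. Random fields. $X(\mathbf t)$, $\mathbf t\in\mathcal D=[0,1]^d$, is a random field with finite second moments, continuous in quadratic mean (and taken jointly measurable). $X\in\mathcal C^{\boldsymbol\alpha}_{\mathbf l}(\mathcal D,C)$ (Hölder condition) means $$\|X(\mathbf t+\mathbf s)-X(\mathbf t)\|^2\le C\sum_{j=1}^k\|\mathbf s^j\|^{\alpha_j}\quad\text{for all }\mathbf t,\mathbf t+\mathbf s\in\mathcal D.$$ Designs. $T_N$ is $cRS(h,\pi,\mathbf l)$ (cross regular sequence): $h=(h_1,\dots,h_k)$ are positive continuous probability densities on $[0,1]$, $\pi(N)=(n_1(N),\dots,n_k(N))$ are positive integers; put $h_i^*=h_j$ and $n_i^*=n_j$ for $i=L_{j-1}+1,\dots,L_j$, $j=1,\dots,k$. It is required that $\prod_{i=1}^d n_i^*(N)=\prod_{j=1}^k n_j(N)^{l_j}=N$ and $n_j(N)\to\infty$ as $N\to\infty$ ($N$ ranging over an infinite set of positive integers for which such a factorization is available). The one-dimensional grid points are defined by $\int_0^{t_{m,i}}h_m^*(v)\,dv=i/n_m^*$,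 $i=0,\dots,n_m^*$, $m=1,\dots,d$, and $T_N$ is the product grid. It partitions $\mathcal D$ into the $N$ hyperrectangles (strata) $\mathcal D_{\mathbf i}=\prod_{m=1}^d[t_{m,i_m},t_{m,i_m+1}]$, $\mathbf i\in\mathbf I=\{(i_1,\dots,i_d):0\le i_m\le n_m^*-1\}$. Quadrature. $I_N(X,T_N)=\sum_{\mathbf i\in\mathbf I}X(\boldsymbol\eta_{\mathbf i})|\mathcal D_{\mathbf i}|$, where $|\mathcal D_{\mathbf i}|$ is the volume and $\boldsymbol\eta_{\mathbf i}$ is uniformly distributed on $\mathcal D_{\mathbf i}$; the $\boldsymbol\eta_{\mathbf i}$ are mutually independent and independent of $X$. The error $\|I(X)-I_N(X,T_N)\|^2$ is the expectation over both $X$ and the $\boldsymbol\eta_{\mathbf i}$. *)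

theory Defs
  imports "HOL-Probability.Probability" "HOL-Library.Landau_Symbols"
begin

text \<open>Points of \<open>d\<close>-dimensional space are functions on the index set \<open>{1..d}\<close> that are
  \<open>undefined\<close> elsewhere (extensional functions), so that the dimension is an ordinary
  natural number and coordinates can be grouped into consecutive blocks.\<close>

definition leb :: "nat \<Rightarrow> (nat \<Rightarrow> real) measure" where
  "leb d = PiM {1..d} (\<lambda>_. lborel)"

definition unit_cube :: "nat \<Rightarrow> (nat \<Rightarrow> real) set" where
  "unit_cube d = PiE {1..d} (\<lambda>_. {0..1})"

definition decomposition :: "nat \<Rightarrow> nat \<Rightarrow> (nat \<Rightarrow> nat) \<Rightarrow> bool" where
  "decomposition d k l \<longleftrightarrow> (\<forall>j\<in>{1..k}. 0 < l j) \<and> (\<Sum>j=1..k. l j) = d"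

definition partial_sum :: "(nat \<Rightarrow> nat) \<Rightarrow> nat \<Rightarrow> nat" where
  "partial_sum l i = (\<Sum>j=1..i. l j)"

definition block :: "(nat \<Rightarrow> nat) \<Rightarrow> nat \<Rightarrow> nat set" where
  "block l j = {partial_sum l (j - 1) + 1..partial_sum l j}"

definition block_norm :: "(nat \<Rightarrow> nat) \<Rightarrow> nat \<Rightarrow> (nat \<Rightarrow> real) \<Rightarrow> real" where
  "block_norm l j s = L2_set s (block l j)"

text \<open>\<open>star l a i\<close> is \<open>a j\<close> for the block \<open>j\<close> containing \<open>i\<close>; since \<open>partial_sum l\<close> is monotone
  and vanishes at \<open>0\<close>, the blocks are disjoint and block \<open>0\<close> is empty.\<close>

definition star :: "(nat \<Rightarrow> nat) \<Rightarrow> (nat \<Rightarrow> 'b) \<Rightarrow> nat \<Rightarrow> 'b" where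
  "star l a i = a (THE j. i \<in> block l j)"

definition square_integrable :: "'a measure \<Rightarrow> ('a \<Rightarrow> real) \<Rightarrow> bool" where
  "square_integrable M \<xi> \<longleftrightarrow> \<xi> \<in> borel_measurable M \<and> integrable M (\<lambda>\<omega>. (\<xi> \<omega>)\<^sup>2)"

definition rv_norm :: "'a measure \<Rightarrow> ('a \<Rightarrow> real) \<Rightarrow> real" where
  "rv_norm M \<xi> = sqrt (\<integral>\<omega>. (\<xi> \<omega>)\<^sup>2 \<partial>M)"

text \<open>The field lives on a probability space \<open>M\<close> that also carries the random sampling points.
  \<open>G\<close> is a sub-sigma-algebra of \<open>M\<close> with respect to which the field is jointly measurable;
  independence of the sampling points from the field means independence from \<open>G\<close>. Independence
  from the sigma-algebra generated by the single values \<open>X t\<close> would not be enough: if \<open>u\<close> is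
  uniform on the unit interval, then \<open>X t = indicator {u} t\<close> is jointly measurable and every
  \<open>X t\<close> is almost surely zero, hence independent of \<open>u\<close>, although \<open>X u = 1\<close>.\<close>

definition random_field ::
  "'a measure \<Rightarrow> 'a measure \<Rightarrow> nat \<Rightarrow> ((nat \<Rightarrow> real) \<Rightarrow> 'a \<Rightarrow> real) \<Rightarrow> bool" where
  "random_field M G d X \<longleftrightarrow>
     subalgebra M G \<and>
     (\<lambda>(t, \<omega>). X t \<omega>) \<in> borel_measurable (restrict_space (leb d) (unit_cube d) \<Otimes>\<^sub>M G) \<and>
     (\<forall>t\<in>unit_cube d. square_integrable M (X t)) \<and>
     (\<forall>t\<in>unit_cube d.
        ((\<lambda>s. rv_norm M (\<lambda>\<omega>. X s \<omega> - X t \<omega>)) \<longlongrightarrow> 0) (at t within unit_cube d))"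

definition holder_class ::
  "'a measure \<Rightarrow> 'a measure \<Rightarrow> nat \<Rightarrow> nat \<Rightarrow> (nat \<Rightarrow> nat) \<Rightarrow> (nat \<Rightarrow> real) \<Rightarrow> real
    \<Rightarrow> ((nat \<Rightarrow> real) \<Rightarrow> 'a \<Rightarrow> real) set" where
  "holder_class M G d k l \<alpha> C =
     {X. random_field M G d X \<and>
         (\<forall>t s. t \<in> unit_cube d \<longrightarrow> (\<lambda>i\<in>{1..d}. t i + s i) \<in> unit_cube d \<longrightarrow>
            (rv_norm M (\<lambda>\<omega>. X (\<lambda>i\<in>{1..d}. t i + s i) \<omega> - X t \<omega>))\<^sup>2
              \<le> C * (\<Sum>j=1..k. block_norm l j s powr \<alpha> j))}"

definition density01 :: "(real \<Rightarrow> real) \<Rightarrow> bool" where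
  "density01 f \<longleftrightarrow> continuous_on {0..1} f \<and> (\<forall>x\<in>{0..1}. 0 < f x) \<and> (f has_integral 1) {0..1}"

definition at_top_in :: "nat set \<Rightarrow> nat filter" where
  "at_top_in S = inf at_top (principal S)"

definition cRS ::
  "nat \<Rightarrow> (nat \<Rightarrow> nat) \<Rightarrow> (nat \<Rightarrow> real \<Rightarrow> real) \<Rightarrow> nat set \<Rightarrow> (nat \<Rightarrow> nat \<Rightarrow> nat) \<Rightarrow> bool" where
  "cRS k l h S n \<longleftrightarrow>
     (\<forall>j\<in>{1..k}. density01 (h j)) \<and>
     infinite S \<and>
     (\<forall>N\<in>S. 0 < N \<and> (\<forall>j\<in>{1..k}. 0 < n N j) \<and> (\<Prod>j=1..k. n N j ^ l j) = N) \<and>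
     (\<forall>j\<in>{1..k}. filterlim (\<lambda>N. n N j) at_top (at_top_in S))"

definition grid_point :: "(real \<Rightarrow> real) \<Rightarrow> nat \<Rightarrow> nat \<Rightarrow> real" where
  "grid_point f n i = (THE t. t \<in> {0..1} \<and> integral {0..t} f = real i / real n)"

text \<open>From here on \<open>p\<close> is the vector of the grid sizes \<open>p 1, \<dots>, p k\<close> for one sample size.\<close>

definition strata_indices :: "nat \<Rightarrow> (nat \<Rightarrow> nat) \<Rightarrow> (nat \<Rightarrow> nat) \<Rightarrow> (nat \<Rightarrow> nat) set" where
  "strata_indices d l p = PiE {1..d} (\<lambda>m. {0..<star l p m})"

definition stratum ::
  "nat \<Rightarrow> (nat \<Rightarrow> nat) \<Rightarrow> (nat \<Rightarrow> real \<Rightarrow> real) \<Rightarrow> (nat \<Rightarrow> nat) \<Rightarrow> (nat \<Rightarrow> nat) \<Rightarrow> (nat \<Rightarrow> real) set"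
  where
  "stratum d l h p i =
     PiE {1..d} (\<lambda>m. {grid_point (star l h m) (star l p m) (i m)
                      ..grid_point (star l h m) (star l p m) (i m + 1)})"

definition uniform_on ::
  "'a measure \<Rightarrow> nat \<Rightarrow> (nat \<Rightarrow> real) set \<Rightarrow> ('a \<Rightarrow> nat \<Rightarrow> real) \<Rightarrow> bool" where
  "uniform_on M d A u \<longleftrightarrow>
     u \<in> measurable M (restrict_space (leb d) A) \<and>
     distr M (leb d) u = uniform_measure (leb d) A"

definition stratified_points ::
  "'a measure \<Rightarrow> 'a measure \<Rightarrow> nat \<Rightarrow> (nat \<Rightarrow> nat) \<Rightarrow> (nat \<Rightarrow> real \<Rightarrow> real) \<Rightarrow> (nat \<Rightarrow> nat)
    \<Rightarrow> ((nat \<Rightarrow> nat) \<Rightarrow> 'a \<Rightarrow> nat \<Rightarrow> real) \<Rightarrow> bool" where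
  "stratified_points M G d l h p \<eta> \<longleftrightarrow>
     (\<forall>i\<in>strata_indices d l p. uniform_on M d (stratum d l h p i) (\<eta> i)) \<and>
     prob_space.indep_vars M (\<lambda>_. leb d) \<eta> (strata_indices d l p) \<and>
     prob_space.indep_set M (sets G)
       (sets (vimage_algebra (space M) (\<lambda>\<omega>. \<lambda>i\<in>strata_indices d l p. \<eta> i \<omega>)
               (PiM (strata_indices d l p) (\<lambda>_. leb d))))"

definition field_integral :: "nat \<Rightarrow> ((nat \<Rightarrow> real) \<Rightarrow> 'a \<Rightarrow> real) \<Rightarrow> 'a \<Rightarrow> real" where
  "field_integral d X \<omega> = (LINT t:unit_cube d|leb d. X t \<omega>)"

definition quadrature ::
  "nat \<Rightarrow> (nat \<Rightarrow> nat) \<Rightarrow> (nat \<Rightarrow> real \<Rightarrow> real) \<Rightarrow> (nat \<Rightarrow> nat)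
    \<Rightarrow> ((nat \<Rightarrow> nat) \<Rightarrow> 'a \<Rightarrow> nat \<Rightarrow> real) \<Rightarrow> ((nat \<Rightarrow> real) \<Rightarrow> 'a \<Rightarrow> real) \<Rightarrow> 'a \<Rightarrow> real" where
  "quadrature d l h p \<eta> X \<omega> =
     (\<Sum>i\<in>strata_indices d l p. X (\<eta> i \<omega>) \<omega> * measure (leb d) (stratum d l h p i))"

definition rate_exponent :: "nat \<Rightarrow> (nat \<Rightarrow> nat) \<Rightarrow> (nat \<Rightarrow> real) \<Rightarrow> real" where
  "rate_exponent k l \<alpha> = inverse (\<Sum>i=1..k. real (l i) / \<alpha> i)"

end

theory Submission imports Defs begin

text \<open>Conditionally on the field, the error is a sum over the strata of the independent centred
  variables \<open>\<integral> X over D_i - |D_i| X(\<eta>_i)\<close>, so the cross terms vanish. The variance of \<open>X(\<eta>_i)\<close>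
  given the field is at most the double average of \<open>(X s - X t)\<^sup>2\<close> over the stratum; taking
  expectations, Tonelli and the Hoelder condition bound it by \<open>C\<close> times the sum of the
  \<open>\<alpha> j\<close>-th powers of the block diameters. As the densities are bounded below by some \<open>c > 0\<close>, each
  side of a stratum is at most \<open>1 / (c n_j)\<close>.\<close>

subsection \<open>Conditional variance of stratified sampling\<close>

text \<open>No conditional expectation is formed. Independence from \<open>G\<close> makes the joint
  law of path and sampling points a product, so a path can be frozen and the points averaged first.
  The obstacle is that a frozen path has to be square integrable on each stratum. This is guaranteed
  only almost surely, and it comes from a bound on the second moments that is uniform on the cube,
  obtained by comparing \<open>X t\<close> with the field at the origin. The main estimates use
  nonnegative integrals, where exchanging the order asks for measurability only; integrability of
  the squared error is then read off from the finite final bound. The estimates are crude on purpose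
  (the double average is twice the variance, and \<open>l j\<close> replaces its square root), since
  such factors only change the constants.\<close>

lemma (in prob_space) second_moment_sum_centered:
  fixes Z :: "'i \<Rightarrow> 'a \<Rightarrow> real"
  assumes "finite I" and ind: "indep_vars (\<lambda>_. borel) Z I"
    and sq: "\<And>i. i \<in> I \<Longrightarrow> integrable M (\<lambda>\<omega>. (Z i \<omega>)\<^sup>2)"
    and centered: "\<And>i. i \<in> I \<Longrightarrow> expectation (Z i) = 0"
  shows "integrable M (\<lambda>\<omega>. (\<Sum>i\<in>I. Z i \<omega>)\<^sup>2)"
    and "expectation (\<lambda>\<omega>. (\<Sum>i\<in>I. Z i \<omega>)\<^sup>2) = (\<Sum>i\<in>I. expectation (\<lambda>\<omega>. (Z i \<omega>)\<^sup>2))"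
proof -
  have meas: "Z i \<in> borel_measurable M" if "i \<in> I" for i
    using ind that unfolding indep_vars_def by auto
  have int: "integrable M (Z i)" if "i \<in> I" for i
    using square_integrable_imp_integrable[OF meas[OF that] sq[OF that]] .
  \<comment> \<open>Two distinct indices form an independent pair, so the mean of the product
    factors into two means, both zero. Only the diagonal survives (Bienayme).\<close>
  have cross: "integrable M (\<lambda>\<omega>. Z i \<omega> * Z j \<omega>) \<and>
      expectation (\<lambda>\<omega>. Z i \<omega> * Z j \<omega>) = (if i = j then expectation (\<lambda>\<omega>. (Z i \<omega>)\<^sup>2) else 0)"
    if "i \<in> I" "j \<in> I" for i j
  proof (cases "i = j")
    case True
    then show ?thesis using sq[OF that(1)] by (simp add: power2_eq_square)
  next
    case False
    have "indep_vars (\<lambda>_. borel) Z {i, j}"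
      using ind that by (intro indep_vars_subset[OF ind]) auto
    moreover have "\<And>m. m \<in> {i, j} \<Longrightarrow> integrable M (Z m)" using int that by auto
    ultimately show ?thesis
      using indep_vars_lebesgue_integral[of "{i, j}" Z] indep_vars_integrable[of "{i, j}" Z]
        False centered that by simp
  qed
  have sq_sum: "(\<Sum>i\<in>I. Z i \<omega>)\<^sup>2 = (\<Sum>i\<in>I. \<Sum>j\<in>I. Z i \<omega> * Z j \<omega>)" for \<omega>
    by (simp add: power2_eq_square sum_product)
  show "integrable M (\<lambda>\<omega>. (\<Sum>i\<in>I. Z i \<omega>)\<^sup>2)"
    unfolding sq_sum using cross by (intro Bochner_Integration.integrable_sum) auto
  show "expectation (\<lambda>\<omega>. (\<Sum>i\<in>I. Z i \<omega>)\<^sup>2) = (\<Sum>i\<in>I. expectation (\<lambda>\<omega>. (Z i \<omega>)\<^sup>2))"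
    unfolding sq_sum using cross assms(1)
    by (subst Bochner_Integration.integral_sum; (auto intro!: Bochner_Integration.integrable_sum)?)
qed

text \<open>The mean minimises the average of \<open>(a - f t)\<close> squared over all constants
  \<open>a\<close>; take \<open>a = f s\<close> and average over \<open>s\<close>. The right-hand
  side involves increments of \<open>f\<close> only, which is what a Hoelder condition
  controls.\<close>

lemma (in prob_space) variance_le_double_integral:
  fixes f :: "'a \<Rightarrow> real"
  assumes [measurable]: "f \<in> borel_measurable M" and sq: "integrable M (\<lambda>x. (f x)\<^sup>2)"
  shows "ennreal (variance f) \<le> (\<integral>\<^sup>+s. (\<integral>\<^sup>+t. ennreal ((f s - f t)\<^sup>2) \<partial>M) \<partial>M)"
proof -
  have int: "integrable M f" by (rule square_integrable_imp_integrable[OF assms])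
  have "ennreal (variance f) \<le> (\<integral>\<^sup>+t. ennreal ((a - f t)\<^sup>2) \<partial>M)" for a
  proof -
    have "variance f \<le> expectation (\<lambda>t. (a - f t)\<^sup>2)"
    proof -
      have "expectation (\<lambda>t. (a - f t)\<^sup>2) = a\<^sup>2 - 2 * a * expectation f + expectation (\<lambda>t. (f t)\<^sup>2)"
        using sq int by (simp add: power2_diff prob_space)
      moreover have "0 \<le> (a - expectation f)\<^sup>2" by simp
      ultimately show ?thesis
        using variance_eq[OF int sq] by (simp add: power2_diff)
    qed
    moreover have "integrable M (\<lambda>t. (a - f t)\<^sup>2)"
      using sq int by (simp add: power2_diff)
    ultimately show ?thesis
      by (subst nn_integral_eq_integral) (auto intro: ennreal_leI)
  qed
  then have "(\<integral>\<^sup>+s. ennreal (variance f) \<partial>M) \<le> (\<integral>\<^sup>+s. (\<integral>\<^sup>+t. ennreal ((f s - f t)\<^sup>2) \<partial>M) \<partial>M)"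
    by (intro nn_integral_mono) simp
  then show ?thesis by (simp add: emeasure_space_1)
qed

text \<open>The weight that the quadrature gives to a stratum is exactly the factor turning a mean
  under the uniform law into an integral over the stratum. This is the source of
  unbiasedness.\<close>

lemma integral_uniform_measure:
  fixes f :: "'a \<Rightarrow> real"
  assumes A: "A \<in> sets L" "emeasure L A \<noteq> 0" "emeasure L A \<noteq> \<infinity>"
    and [measurable]: "f \<in> borel_measurable L"
  shows "integrable (uniform_measure L A) f \<longleftrightarrow> set_integrable L A f"
    and "measure L A * integral\<^sup>L (uniform_measure L A) f = (LINT t:A|L. f t)"
proof -
  have m: "0 < measure L A" "emeasure L A = ennreal (measure L A)"
    using A(2,3) emeasure_eq_ennreal_measure[of L A] by (auto simp: measure_def enn2real_positive_iff top.not_eq_extremum zero_less_iff_neq_zero)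
  \<comment> \<open>The extended real quotient is rewritten as a real-valued density, the form
    required for computing Bochner integrals against a density.\<close>
  have eq: "uniform_measure L A = density L (\<lambda>x. ennreal (indicator A x / measure L A))"
    unfolding uniform_measure_def m(2)
    by (rule density_cong) (use A(1) m(1) in \<open>auto simp: indicator_def divide_ennreal ennreal_1[symmetric] simp del: ennreal_1\<close>)
  have [measurable]: "A \<in> sets L" by fact
  have "integrable (uniform_measure L A) f \<longleftrightarrow> integrable L (\<lambda>x. (indicator A x * f x) / measure L A)"
    unfolding eq by (subst integrable_density) (use m in auto)
  also have "\<dots> \<longleftrightarrow> set_integrable L A f"
    unfolding set_integrable_def
    using m(1) integrable_mult_left_iff[of L "1 / measure L A" "\<lambda>x. indicator A x * f x"] by simp
  finally show "integrable (uniform_measure L A) f \<longleftrightarrow> set_integrable L A f" .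
  show "measure L A * integral\<^sup>L (uniform_measure L A) f = (LINT t:A|L. f t)"
    unfolding eq set_lebesgue_integral_def by (subst integral_density) (use m in auto)
qed

lemma (in prob_space) stratified_error_deterministic:
  fixes f :: "'b \<Rightarrow> real" and A :: "'i \<Rightarrow> 'b set"
  assumes "finite I"
    and A: "\<And>i. i \<in> I \<Longrightarrow> A i \<in> sets L" "\<And>i. i \<in> I \<Longrightarrow> emeasure L (A i) \<noteq> 0"
      "\<And>i. i \<in> I \<Longrightarrow> emeasure L (A i) \<noteq> \<infinity>"
    and D: "AE x in L. indicator D x = (\<Sum>i\<in>I. indicator (A i) x :: real)" "D \<in> sets L"
    and distr: "\<And>i. i \<in> I \<Longrightarrow> distr M L (\<eta> i) = uniform_measure L (A i)"
    and ind: "indep_vars (\<lambda>_. L) \<eta> I"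
    and f[measurable]: "f \<in> borel_measurable L"
    and sq: "\<And>i. i \<in> I \<Longrightarrow> (\<integral>\<^sup>+t. ennreal ((f t)\<^sup>2) \<partial>uniform_measure L (A i)) < \<infinity>"
  shows "(\<integral>\<^sup>+\<omega>. ennreal (((LINT t:D|L. f t) - (\<Sum>i\<in>I. f (\<eta> i \<omega>) * measure L (A i)))\<^sup>2) \<partial>M)
    \<le> (\<Sum>i\<in>I. ennreal ((measure L (A i))\<^sup>2) * (\<integral>\<^sup>+s. (\<integral>\<^sup>+t. ennreal ((f s - f t)\<^sup>2)
          \<partial>uniform_measure L (A i)) \<partial>uniform_measure L (A i)))"
proof -
  define U where "U i = uniform_measure L (A i)" for i
  define w where "w i = measure L (A i)" for i
  define Z where "Z i \<omega> = w i * (integral\<^sup>L (U i) f - f (\<eta> i \<omega>))" for i \<omega>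
  have rv: "random_variable L (\<eta> i)" if "i \<in> I" for i
    using ind that unfolding indep_vars_def by auto
  have U: "prob_space (U i)" if "i \<in> I" for i
    unfolding U_def using A that by (intro prob_space_uniform_measure) auto
  have fU[measurable]: "f \<in> borel_measurable (U i)" for i
    unfolding U_def by measurable
  have sqU: "integrable (U i) (\<lambda>t. (f t)\<^sup>2)" if "i \<in> I" for i
    using sq[OF that] by (intro integrableI_nonneg) (auto simp: U_def)
  have intU: "integrable (U i) f" if "i \<in> I" for i
  proof -
    interpret U: prob_space "U i" using U[OF that] .
    show ?thesis by (rule U.square_integrable_imp_integrable[OF fU sqU[OF that]])
  qed
  have setint: "set_integrable L (A i) f" if "i \<in> I" for i
    using intU[OF that] integral_uniform_measure(1)[OF A(1-3)[OF that] f] by (simp add: U_def)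
  \<comment> \<open>The sets \<open>A i\<close> may overlap in null sets, so the integrand is split
    only almost everywhere.\<close>
  have AE: "AE t in L. indicator D t *\<^sub>R f t = (\<Sum>i\<in>I. indicator (A i) t * f t)"
    using D(1) by eventually_elim (simp only: sum_distrib_right[symmetric] real_scaleR_def)
  have "(LINT t:D|L. f t) = (LINT t|L. (\<Sum>i\<in>I. indicator (A i) t * f t))"
    unfolding set_lebesgue_integral_def using D(2) assms(1) A(1)
    by (intro integral_cong_AE borel_measurable_times borel_measurable_sum borel_measurable_scaleR
        borel_measurable_indicator f AE)
  also have "\<dots> = (\<Sum>i\<in>I. LINT t:A i|L. f t)"
    unfolding set_lebesgue_integral_def
    using setint by (subst Bochner_Integration.integral_sum) (auto simp: set_integrable_def)
  also have "\<dots> = (\<Sum>i\<in>I. w i * integral\<^sup>L (U i) f)"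
    using integral_uniform_measure(2)[OF A(1-3) f] by (intro sum.cong) (auto simp: U_def w_def)
  finally have err: "(LINT t:D|L. f t) - (\<Sum>i\<in>I. f (\<eta> i \<omega>) * w i) = (\<Sum>i\<in>I. Z i \<omega>)" for \<omega>
    by (simp add: Z_def algebra_simps sum_subtractf)
  have distrU: "U i = distr M L (\<eta> i)" if "i \<in> I" for i
    using distr[OF that] by (simp add: U_def)
  have indZ: "indep_vars (\<lambda>_. borel) Z I"
    unfolding Z_def by (rule indep_vars_compose2[OF ind]) measurable
  have Z0: "expectation (Z i) = 0" if "i \<in> I" for i
  proof -
    have "integrable M (\<lambda>\<omega>. f (\<eta> i \<omega>))"
      using intU[OF that] rv[OF that] unfolding distrU[OF that] by (subst (asm) integrable_distr_eq) auto
    moreover have "integral\<^sup>L (U i) f = expectation (\<lambda>\<omega>. f (\<eta> i \<omega>))"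
      unfolding distrU[OF that] using rv[OF that] by (subst integral_distr) auto
    ultimately show ?thesis unfolding Z_def by (simp add: prob_space)
  qed
  have Zsq: "integrable M (\<lambda>\<omega>. (Z i \<omega>)\<^sup>2)"
    "expectation (\<lambda>\<omega>. (Z i \<omega>)\<^sup>2) = (w i)\<^sup>2 * (LINT t|U i. (f t - integral\<^sup>L (U i) f)\<^sup>2)" if "i \<in> I" for i
  proof -
    interpret U: prob_space "U i" using U[OF that] .
    have "integrable (U i) (\<lambda>t. (f t - integral\<^sup>L (U i) f)\<^sup>2)"
      using intU[OF that] sqU[OF that] by (simp add: power2_diff)
    then have "integrable M (\<lambda>\<omega>. (f (\<eta> i \<omega>) - integral\<^sup>L (U i) f)\<^sup>2)"
      using rv[OF that] by (subst (asm) (1) distrU[OF that], subst (asm) integrable_distr_eq) auto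
    moreover have "(LINT t|U i. (f t - integral\<^sup>L (U i) f)\<^sup>2)
        = expectation (\<lambda>\<omega>. (f (\<eta> i \<omega>) - integral\<^sup>L (U i) f)\<^sup>2)"
      using rv[OF that] by (subst (1) distrU[OF that], subst integral_distr) auto
    ultimately show "integrable M (\<lambda>\<omega>. (Z i \<omega>)\<^sup>2)"
      "expectation (\<lambda>\<omega>. (Z i \<omega>)\<^sup>2) = (w i)\<^sup>2 * (LINT t|U i. (f t - integral\<^sup>L (U i) f)\<^sup>2)"
      unfolding Z_def by (simp_all add: power_mult_distrib power2_commute[of "f _"])
  qed
  have "(\<integral>\<^sup>+\<omega>. ennreal ((\<Sum>i\<in>I. Z i \<omega>)\<^sup>2) \<partial>M) = ennreal (\<Sum>i\<in>I. expectation (\<lambda>\<omega>. (Z i \<omega>)\<^sup>2))"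
    using second_moment_sum_centered[OF assms(1) indZ Zsq(1) Z0]
    by (subst nn_integral_eq_integral) auto
  also have "\<dots> = (\<Sum>i\<in>I. ennreal ((w i)\<^sup>2) * ennreal (LINT t|U i. (f t - integral\<^sup>L (U i) f)\<^sup>2))"
    using Zsq(2) by (subst sum_ennreal[symmetric]) (auto intro!: sum.cong simp: ennreal_mult)
  also have "\<dots> \<le> (\<Sum>i\<in>I. ennreal ((w i)\<^sup>2) * (\<integral>\<^sup>+s. (\<integral>\<^sup>+t. ennreal ((f s - f t)\<^sup>2) \<partial>U i) \<partial>U i))"
    using prob_space.variance_le_double_integral[OF U fU sqU]
    by (intro sum_mono mult_left_mono) auto
  finally show ?thesis unfolding err[symmetric] unfolding w_def U_def .
qed

lemma (in prob_space) stratified_error_second_moment: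
  fixes X :: "'b \<Rightarrow> 'a \<Rightarrow> real" and A :: "'i \<Rightarrow> 'b set"
  assumes L: "sigma_finite_measure L" and sub: "subalgebra M G" and "finite I"
    and A: "\<And>i. i \<in> I \<Longrightarrow> A i \<in> sets L" "\<And>i. i \<in> I \<Longrightarrow> emeasure L (A i) \<noteq> 0"
      "\<And>i. i \<in> I \<Longrightarrow> emeasure L (A i) \<noteq> \<infinity>"
    and D: "AE x in L. indicator D x = (\<Sum>i\<in>I. indicator (A i) x :: real)" "D \<in> sets L"
    and distr: "\<And>i. i \<in> I \<Longrightarrow> distr M L (\<eta> i) = uniform_measure L (A i)"
    and ind: "indep_vars (\<lambda>_. L) \<eta> I"
    and indG: "indep_set (sets G) (sets (vimage_algebra (space M) (\<lambda>\<omega>. \<lambda>i\<in>I. \<eta> i \<omega>) (PiM I (\<lambda>_. L))))"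
    and X[measurable]: "(\<lambda>(t, \<omega>). X t \<omega>) \<in> borel_measurable (L \<Otimes>\<^sub>M G)"
    and B: "\<And>i t. i \<in> I \<Longrightarrow> t \<in> A i \<Longrightarrow> (\<integral>\<^sup>+\<omega>. ennreal ((X t \<omega>)\<^sup>2) \<partial>M) \<le> ennreal B"
    and H: "\<And>i s t. i \<in> I \<Longrightarrow> s \<in> A i \<Longrightarrow> t \<in> A i \<Longrightarrow>
        (\<integral>\<^sup>+\<omega>. ennreal ((X s \<omega> - X t \<omega>)\<^sup>2) \<partial>M) \<le> ennreal H"
  shows "(\<lambda>\<omega>. (LINT t:D|L. X t \<omega>) - (\<Sum>i\<in>I. X (\<eta> i \<omega>) \<omega> * measure L (A i))) \<in> borel_measurable M"
    and "(\<integral>\<^sup>+\<omega>. ennreal (((LINT t:D|L. X t \<omega>) - (\<Sum>i\<in>I. X (\<eta> i \<omega>) \<omega> * measure L (A i)))\<^sup>2) \<partial>M)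
      \<le> (\<Sum>i\<in>I. ennreal ((measure L (A i))\<^sup>2) * ennreal H)"
proof -
  interpret L: sigma_finite_measure L by fact
  \<comment> \<open>\<open>\<mu>\<close> is the probability restricted to the sub-sigma-algebra
    \<open>G\<close>, written as an image under the identity. \<open>E\<close> below bundles all
    sampling points into one random element, so that independence concerns a single map.\<close>
  define \<mu> where "\<mu> = distr M G (\<lambda>\<omega>. \<omega>)"
  define P where "P = PiM I (\<lambda>_. L)"
  define E where "E \<omega> = (\<lambda>i\<in>I. \<eta> i \<omega>)" for \<omega>
  define w where "w i = measure L (A i)" for i
  define U where "U i = uniform_measure L (A i)" for i
  \<comment> \<open>\<open>F\<close> separates the two roles of the outcome: \<open>\<omega>\<close>
    selects the path and \<open>e\<close> the configuration of points. The actual error is the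
    diagonal \<open>F \<omega> (E \<omega>)\<close>.\<close>
  define F where "F \<omega> e = (LINT t:D|L. X t \<omega>) - (\<Sum>i\<in>I. X (e i) \<omega> * w i)" for \<omega> e
  have idG[measurable]: "(\<lambda>\<omega>. \<omega>) \<in> measurable M G"
    using sub unfolding subalgebra_def measurable_def by (auto dest: sets.sets_into_space)
  have rv[measurable]: "random_variable L (\<eta> i)" if "i \<in> I" for i
    using ind that unfolding indep_vars_def by auto
  have E[measurable]: "E \<in> measurable M P"
    unfolding E_def P_def by (rule measurable_restrict) (rule rv)
  have [measurable_cong]: "sets \<mu> = sets G" by (simp add: \<mu>_def)
  have [measurable_cong, simp]: "sets (U i) = sets L" for i by (simp add: U_def)
  have [measurable]: "D \<in> sets L" by fact
  have F[measurable]: "(\<lambda>(\<omega>, e). F \<omega> e) \<in> borel_measurable (G \<Otimes>\<^sub>M P)"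
    unfolding F_def P_def set_lebesgue_integral_def by measurable
  interpret \<mu>: prob_space \<mu> unfolding \<mu>_def by (rule prob_space_distr) measurable
  interpret E: prob_space "distr M P E" by (rule prob_space_distr) measurable
  have U: "prob_space (U i)" if "i \<in> I" for i
    unfolding U_def using A that by (intro prob_space_uniform_measure) auto
  have FE: "F \<omega> (E \<omega>') = (LINT t:D|L. X t \<omega>) - (\<Sum>i\<in>I. X (\<eta> i \<omega>') \<omega> * w i)" for \<omega> \<omega>'
    by (simp add: F_def E_def)
  have "(\<lambda>\<omega>. F \<omega> (E \<omega>)) \<in> borel_measurable M" by measurable
  then show "(\<lambda>\<omega>. (LINT t:D|L. X t \<omega>) - (\<Sum>i\<in>I. X (\<eta> i \<omega>) \<omega> * measure L (A i))) \<in> borel_measurable M"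
    unfolding FE w_def .
  \<comment> \<open>Independence of the two sigma-algebras is the product rule on measurable
    rectangles, and these determine the joint law.\<close>
  have joint: "\<mu> \<Otimes>\<^sub>M distr M P E = distr M (G \<Otimes>\<^sub>M P) (\<lambda>\<omega>. (\<omega>, E \<omega>))"
  proof -
    have "emeasure \<mu> a * emeasure (distr M P E) b
        = emeasure (distr M (G \<Otimes>\<^sub>M P) (\<lambda>\<omega>. (\<omega>, E \<omega>))) (a \<times> b)"
      if a: "a \<in> sets \<mu>" and b: "b \<in> sets (distr M P E)" for a b
    proof -
      have G: "a \<in> sets G" "a \<subseteq> space M" "b \<in> sets P"
        using a b sub sets.sets_into_space[of a G] by (auto simp: \<mu>_def subalgebra_def)
      have "E -` b \<inter> space M \<in> sets (vimage_algebra (space M) E P)"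
        using measurable_space[OF E] G(3) by (auto simp: sets_vimage_algebra2)
      then have "prob (a \<inter> (E -` b \<inter> space M)) = prob a * prob (E -` b \<inter> space M)"
        using indep_setD[OF indG G(1)] unfolding P_def E_def by simp
      moreover have "(\<lambda>\<omega>. (\<omega>, E \<omega>)) -` (a \<times> b) \<inter> space M = a \<inter> (E -` b \<inter> space M)"
        using G(2) by auto
      ultimately show ?thesis
        unfolding \<mu>_def using G
        by (simp add: emeasure_distr emeasure_eq_measure ennreal_mult Int_absorb2)
    qed
    then show ?thesis
      by (intro pair_measure_eqI \<mu>.sigma_finite_measure_axioms E.sigma_finite_measure_axioms)
        (auto simp: \<mu>_def cong: sets_pair_measure_cong)
  qed
  \<comment> \<open>Freezing the field and still sampling \<open>\<eta>\<close> on \<open>M\<close> is legitimate by independence from \<open>G\<close>.\<close>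
  have inner: "(\<integral>\<^sup>+\<omega>'. ennreal ((F \<omega> (E \<omega>'))\<^sup>2) \<partial>M)
      \<le> (\<Sum>i\<in>I. ennreal ((w i)\<^sup>2) * (\<integral>\<^sup>+s. (\<integral>\<^sup>+t. ennreal ((X s \<omega> - X t \<omega>)\<^sup>2) \<partial>U i) \<partial>U i))"
    if "\<omega> \<in> space G" "\<And>i. i \<in> I \<Longrightarrow> (\<integral>\<^sup>+t. ennreal ((X t \<omega>)\<^sup>2) \<partial>U i) < \<infinity>" for \<omega>
    unfolding FE w_def U_def using that(2)
    by (intro stratified_error_deterministic assms measurable_Pair_compose_split[OF X])
      (auto simp: U_def that(1))
  have AEU: "AE t in U i. t \<in> A i" if "i \<in> I" for i
    unfolding U_def using A(1)[OF that] by (intro AE_uniform_measureI) auto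
  \<comment> \<open>Averaging \<open>B\<close> over the stratum and exchanging the integrals gives a
    finite mean, hence a value that is finite for almost every path.\<close>
  have fin: "AE \<omega> in \<mu>. (\<integral>\<^sup>+t. ennreal ((X t \<omega>)\<^sup>2) \<partial>U i) < \<infinity>" if "i \<in> I" for i
  proof -
    interpret U: prob_space "U i" using U[OF that] .
    interpret pair_sigma_finite "U i" \<mu> ..
    have "(\<integral>\<^sup>+\<omega>. (\<integral>\<^sup>+t. ennreal ((X t \<omega>)\<^sup>2) \<partial>U i) \<partial>\<mu>) = (\<integral>\<^sup>+t. (\<integral>\<^sup>+\<omega>. ennreal ((X t \<omega>)\<^sup>2) \<partial>\<mu>) \<partial>U i)"
      by (rule Fubini') measurable
    also have "\<dots> \<le> (\<integral>\<^sup>+t. ennreal B \<partial>U i)"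
    proof (rule nn_integral_mono_AE, use AEU[OF that] in eventually_elim)
      fix t assume t: "t \<in> A i"
      have [measurable]: "t \<in> space L" using sets.sets_into_space[OF A(1)[OF that]] t by auto
      show "(\<integral>\<^sup>+\<omega>. ennreal ((X t \<omega>)\<^sup>2) \<partial>\<mu>) \<le> ennreal B"
        unfolding \<mu>_def using B[OF that t] by (subst nn_integral_distr) auto
    qed
    also have "\<dots> < \<infinity>" by (simp add: U.emeasure_space_1)
    finally have "(\<integral>\<^sup>+\<omega>. (\<integral>\<^sup>+t. ennreal ((X t \<omega>)\<^sup>2) \<partial>U i) \<partial>\<mu>) \<noteq> \<infinity>" by simp
    moreover have "(\<lambda>\<omega>. \<integral>\<^sup>+t. ennreal ((X t \<omega>)\<^sup>2) \<partial>U i) \<in> borel_measurable \<mu>" by measurable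
    ultimately have "AE \<omega> in \<mu>. (\<integral>\<^sup>+t. ennreal ((X t \<omega>)\<^sup>2) \<partial>U i) \<noteq> \<infinity>"
      by (rule nn_integral_PInf_AE[rotated])
    then show ?thesis by (simp add: less_top)
  qed
  have "(\<integral>\<^sup>+\<omega>. ennreal ((F \<omega> (E \<omega>))\<^sup>2) \<partial>M)
      = (\<integral>\<^sup>+z. (case z of (\<omega>, e) \<Rightarrow> ennreal ((F \<omega> e)\<^sup>2)) \<partial>distr M (G \<Otimes>\<^sub>M P) (\<lambda>\<omega>. (\<omega>, E \<omega>)))"
    by (subst nn_integral_distr) auto
  also have "\<dots> = (\<integral>\<^sup>+\<omega>. (\<integral>\<^sup>+e. ennreal ((F \<omega> e)\<^sup>2) \<partial>distr M P E) \<partial>\<mu>)"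
    unfolding joint[symmetric] by (subst E.nn_integral_fst[symmetric]) (auto split: prod.split)
  also have "\<dots> = (\<integral>\<^sup>+\<omega>. (\<integral>\<^sup>+\<omega>'. ennreal ((F \<omega> (E \<omega>'))\<^sup>2) \<partial>M) \<partial>\<mu>)"
    by (intro nn_integral_cong nn_integral_distr) (auto simp: \<mu>_def)
  also have "\<dots> \<le> (\<integral>\<^sup>+\<omega>. (\<Sum>i\<in>I. ennreal ((w i)\<^sup>2) *
      (\<integral>\<^sup>+s. (\<integral>\<^sup>+t. ennreal ((X s \<omega> - X t \<omega>)\<^sup>2) \<partial>U i) \<partial>U i)) \<partial>\<mu>)"
  proof (rule nn_integral_mono_AE)
    have "AE \<omega> in \<mu>. \<forall>i\<in>I. (\<integral>\<^sup>+t. ennreal ((X t \<omega>)\<^sup>2) \<partial>U i) < \<infinity>"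
      using fin assms(3) by (subst AE_finite_all) auto
    then show "AE \<omega> in \<mu>. (\<integral>\<^sup>+\<omega>'. ennreal ((F \<omega> (E \<omega>'))\<^sup>2) \<partial>M)
      \<le> (\<Sum>i\<in>I. ennreal ((w i)\<^sup>2) * (\<integral>\<^sup>+s. (\<integral>\<^sup>+t. ennreal ((X s \<omega> - X t \<omega>)\<^sup>2) \<partial>U i) \<partial>U i))"
      using AE_space by eventually_elim (rule inner, auto simp: \<mu>_def)
  qed
  also have "\<dots> = (\<Sum>i\<in>I. ennreal ((w i)\<^sup>2) *
      (\<integral>\<^sup>+\<omega>. (\<integral>\<^sup>+s. (\<integral>\<^sup>+t. ennreal ((X s \<omega> - X t \<omega>)\<^sup>2) \<partial>U i) \<partial>U i) \<partial>\<mu>))"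
  proof -
    have [measurable]: "(\<lambda>\<omega>. \<integral>\<^sup>+s. (\<integral>\<^sup>+t. ennreal ((X s \<omega> - X t \<omega>)\<^sup>2) \<partial>U i) \<partial>U i) \<in> borel_measurable \<mu>"
      if "i \<in> I" for i
    proof -
      interpret U: prob_space "U i" using U[OF that] .
      show ?thesis by measurable
    qed
    show ?thesis by (subst nn_integral_sum) (auto intro!: sum.cong nn_integral_cmult)
  qed
  also have "\<dots> \<le> (\<Sum>i\<in>I. ennreal ((w i)\<^sup>2) * ennreal H)"
  proof (intro sum_mono mult_left_mono)
    fix i assume i: "i \<in> I"
    interpret U: prob_space "U i" using U[OF i] .
    \<comment> \<open>Two exchanges move the expectation inside both spatial averages, where
      \<open>s\<close> and \<open>t\<close> are fixed and the bound \<open>H\<close>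
      applies.\<close>
    interpret pair_sigma_finite "U i" \<mu> ..
    have "(\<integral>\<^sup>+\<omega>. (\<integral>\<^sup>+s. (\<integral>\<^sup>+t. ennreal ((X s \<omega> - X t \<omega>)\<^sup>2) \<partial>U i) \<partial>U i) \<partial>\<mu>)
      = (\<integral>\<^sup>+s. (\<integral>\<^sup>+\<omega>. (\<integral>\<^sup>+t. ennreal ((X s \<omega> - X t \<omega>)\<^sup>2) \<partial>U i) \<partial>\<mu>) \<partial>U i)"
      by (rule Fubini') measurable
    also have "\<dots> = (\<integral>\<^sup>+s. (\<integral>\<^sup>+t. (\<integral>\<^sup>+\<omega>. ennreal ((X s \<omega> - X t \<omega>)\<^sup>2) \<partial>\<mu>) \<partial>U i) \<partial>U i)"
    proof (rule nn_integral_cong)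
      fix s assume "s \<in> space (U i)"
      then have [measurable]: "s \<in> space L" by (simp add: U_def)
      show "(\<integral>\<^sup>+\<omega>. (\<integral>\<^sup>+t. ennreal ((X s \<omega> - X t \<omega>)\<^sup>2) \<partial>U i) \<partial>\<mu>)
        = (\<integral>\<^sup>+t. (\<integral>\<^sup>+\<omega>. ennreal ((X s \<omega> - X t \<omega>)\<^sup>2) \<partial>\<mu>) \<partial>U i)"
        by (rule Fubini') measurable
    qed
    also have "\<dots> \<le> (\<integral>\<^sup>+s. (\<integral>\<^sup>+t. ennreal H \<partial>U i) \<partial>U i)"
    proof (rule nn_integral_mono_AE, use AEU[OF i] in eventually_elim,
        rule nn_integral_mono_AE, use AEU[OF i] in eventually_elim)
      fix s t assume st: "s \<in> A i" "t \<in> A i"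
      have [measurable]: "s \<in> space L" "t \<in> space L"
        using sets.sets_into_space[OF A(1)[OF i]] st by auto
      show "(\<integral>\<^sup>+\<omega>. ennreal ((X s \<omega> - X t \<omega>)\<^sup>2) \<partial>\<mu>) \<le> ennreal H"
        unfolding \<mu>_def using H[OF i st] by (subst nn_integral_distr) auto
    qed
    also have "\<dots> = ennreal H" by (simp add: U.emeasure_space_1)
    finally show "(\<integral>\<^sup>+\<omega>. (\<integral>\<^sup>+s. (\<integral>\<^sup>+t. ennreal ((X s \<omega> - X t \<omega>)\<^sup>2) \<partial>U i) \<partial>U i) \<partial>\<mu>) \<le> ennreal H" .
  qed simp
  finally show "(\<integral>\<^sup>+\<omega>. ennreal (((LINT t:D|L. X t \<omega>) - (\<Sum>i\<in>I. X (\<eta> i \<omega>) \<omega> * measure L (A i)))\<^sup>2) \<partial>M)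
      \<le> (\<Sum>i\<in>I. ennreal ((measure L (A i))\<^sup>2) * ennreal H)"
    unfolding FE w_def .
qed

subsection \<open>Blocks, grid points and strata\<close>

lemma partial_sum_mono: "i \<le> j \<Longrightarrow> partial_sum l i \<le> partial_sum l j"
  unfolding partial_sum_def by (intro sum_mono2) auto

text \<open>The index has to be positive: by truncated subtraction \<open>block l 0\<close> is empty
  whatever \<open>l 0\<close> is.\<close>

lemma card_block: "1 \<le> j \<Longrightarrow> card (block l j) = l j"
  by (cases j) (auto simp: block_def partial_sum_def)

lemma block_disjoint: "disjoint_family (block l)"
proof -
  have "block l i \<inter> block l j = {}" if "i < j" for i j
    using partial_sum_mono[of i "j - 1" l] that by (force simp: block_def)
  then show ?thesis
    unfolding disjoint_family_on_def by (metis Int_commute linorder_neqE_nat)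
qed

lemma UN_blocks: "(\<Union>j\<in>{1..k}. block l j) = {1..partial_sum l k}"
proof (induction k)
  case (Suc k)
  have "{1..Suc k} = insert (Suc k) {1..k}" by auto
  then show ?case
    using Suc partial_sum_mono[of k "Suc k" l] by (auto simp: block_def)
qed (simp add: partial_sum_def)

lemma star_eq: "i \<in> block l j \<Longrightarrow> star l a i = a j"
proof -
  assume i: "i \<in> block l j"
  then have "(THE j. i \<in> block l j) = j"
    using block_disjoint[of l] unfolding disjoint_family_on_def by (intro the_equality) auto
  then show ?thesis by (simp add: star_def)
qed

lemma decomposition_blocks:
  assumes "decomposition d k l"
  shows "{1..d} = (\<Union>j\<in>{1..k}. block l j)"
  using assms UN_blocks[of l k] by (simp add: decomposition_def partial_sum_def)

text \<open>Regroups the coordinates by blocks. With \<open>g\<close> the identity it identifies the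
  product of the grid sizes over all coordinates with the sample size, and so yields both the number
  of strata and the volume bound.\<close>

lemma prod_star:
  fixes g :: "'b \<Rightarrow> 'c::comm_monoid_mult"
  assumes "decomposition d k l"
  shows "(\<Prod>m=1..d. g (star l a m)) = (\<Prod>j=1..k. g (a j) ^ l j)"
proof -
  have "(\<Prod>m=1..d. g (star l a m)) = (\<Prod>j=1..k. \<Prod>m\<in>block l j. g (star l a m))"
    unfolding decomposition_blocks[OF assms] using block_disjoint[of l]
    by (intro prod.UNION_disjoint) (auto simp: block_def disjoint_family_on_def)
  also have "\<dots> = (\<Prod>j=1..k. \<Prod>m\<in>block l j. g (a j))"
    by (intro prod.cong) (auto simp: star_eq)
  finally show ?thesis by (simp add: card_block)
qed

section \<open>One-dimensional grids given by quantiles of a density\<close>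

lemma density01_lower_bound:
  assumes "density01 f"
  obtains c where "0 < c" "\<And>x. x \<in> {0..1} \<Longrightarrow> c \<le> f x"
proof -
  obtain y where "y \<in> {0..1}" "\<forall>x\<in>{0..1}. f y \<le> f x"
    using continuous_attains_inf[of "{0..1::real}" f] assms by (auto simp: density01_def)
  then show thesis
    using assms that[of "f y"] by (auto simp: density01_def)
qed

text \<open>The distribution function grows at rate at least \<open>c\<close>. This serves twice: it
  makes the quantiles unique, and it bounds the distance between neighbouring ones.\<close>

lemma integral_increment_ge:
  assumes "density01 f" and c: "\<And>x. x \<in> {0..1} \<Longrightarrow> c \<le> f x"
    and ab: "0 \<le> a" "a \<le> b" "b \<le> 1"
  shows "c * (b - a) \<le> integral {0..b} f - integral {0..a} f"
proof -
  have int: "f integrable_on {u..v}" if "0 \<le> u" "v \<le> 1" for u v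
  proof (rule integrable_continuous_real)
    show "continuous_on {u..v} f"
      using assms(1) that unfolding density01_def by (meson atLeastatMost_subset_iff continuous_on_subset)
  qed
  have "integral {0..a} f + integral {a..b} f = integral {0..b} f"
    using ab int by (intro Henstock_Kurzweil_Integration.integral_combine) auto
  moreover have "integral {a..b} (\<lambda>_. c) \<le> integral {a..b} f"
    using ab int c by (intro integral_le) auto
  ultimately show ?thesis using ab by (simp add: mult.commute)
qed

lemma integral_strict_mono:
  assumes "density01 f" "0 \<le> a" "a < b" "b \<le> 1"
  shows "integral {0..a} f < integral {0..b} f"
proof -
  obtain c where "0 < c" "\<And>x. x \<in> {0..1} \<Longrightarrow> c \<le> f x"
    using density01_lower_bound[OF assms(1)] by blast
  then have "c * (b - a) \<le> integral {0..b} f - integral {0..a} f" "0 < c * (b - a)"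
    using assms by (auto intro!: integral_increment_ge)
  then show ?thesis by linarith
qed

text \<open>Discharges the definite description: existence by the intermediate value theorem,
  uniqueness because the distribution function is strictly increasing.\<close>

lemma grid_point:
  assumes f: "density01 f" and n: "0 < n" "i \<le> n"
  shows "grid_point f n i \<in> {0..1}" "integral {0..grid_point f n i} f = real i / real n"
proof -
  have "f integrable_on {0..1}" "integral {0..1} f = 1"
    using f by (auto simp: density01_def has_integral_iff)
  then have "\<exists>t\<ge>0. t \<le> 1 \<and> integral {0..t} f = real i / real n"
    using n by (intro IVT' indefinite_integral_continuous_1) auto
  moreover have "s = t" if "s \<in> {0..1}" "t \<in> {0..1}" "integral {0..s} f = integral {0..t} f" for s t
    using integral_strict_mono[OF f, of s t] integral_strict_mono[OF f, of t s] that
    by (cases s t rule: linorder_cases) auto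
  ultimately have "\<exists>!t. t \<in> {0..1} \<and> integral {0..t} f = real i / real n"
    by (metis atLeastAtMost_iff)
  from theI'[OF this]
  show "grid_point f n i \<in> {0..1}" "integral {0..grid_point f n i} f = real i / real n"
    unfolding grid_point_def by auto
qed

lemma grid_point_0:
  assumes f: "density01 f" and n: "0 < n"
  shows "grid_point f n 0 = 0"
  using grid_point[OF f n, of 0] integral_strict_mono[OF f, of 0 "grid_point f n 0"]
  by (cases "grid_point f n 0 = 0") auto

lemma grid_point_n:
  assumes f: "density01 f" and n: "0 < n"
  shows "grid_point f n n = 1"
proof -
  have "integral {0..1} f = 1" using f by (auto simp: density01_def has_integral_iff)
  then show ?thesis
    using grid_point[OF f n, of n] integral_strict_mono[OF f, of "grid_point f n n" 1] n
    by (cases "grid_point f n n = 1") auto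
qed

lemma grid_point_less:
  assumes f: "density01 f" and "i < n"
  shows "grid_point f n i < grid_point f n (i + 1)"
proof (rule ccontr)
  have n: "0 < n" "i \<le> n" "i + 1 \<le> n" using assms by auto
  assume "\<not> ?thesis"
  then have "integral {0..grid_point f n (i + 1)} f \<le> integral {0..grid_point f n i} f"
    using integral_strict_mono[OF f, of "grid_point f n (i + 1)" "grid_point f n i"]
      grid_point(1)[OF f n(1,2)] grid_point(1)[OF f n(1,3)]
    by (cases "grid_point f n (i + 1) = grid_point f n i") auto
  then show False
    unfolding grid_point(2)[OF f n(1,2)] grid_point(2)[OF f n(1,3)] using n by (simp add: divide_le_cancel)
qed

text \<open>Neighbouring grid points enclose mass \<open>1 / n\<close>, and an interval on which the
  density is at least \<open>c\<close> carries mass at least \<open>c\<close> times its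
  length.\<close>

lemma grid_point_gap:
  assumes f: "density01 f" and "i < n" and c: "0 < c" "\<And>x. x \<in> {0..1} \<Longrightarrow> c \<le> f x"
  shows "grid_point f n (i + 1) - grid_point f n i \<le> 1 / (c * real n)"
proof -
  have n: "0 < n" "i \<le> n" "i + 1 \<le> n" using assms by auto
  have "c * (grid_point f n (i + 1) - grid_point f n i) \<le> real (i + 1) / real n - real i / real n"
    using integral_increment_ge[OF f c(2), of "grid_point f n i" "grid_point f n (i + 1)"]
      grid_point[OF f n(1,2)] grid_point[OF f n(1,3)] grid_point_less[OF f assms(2)] by simp
  also have "\<dots> = 1 / real n" by (simp add: add_divide_distrib)
  finally show ?thesis using c n by (simp add: field_simps)
qed

text \<open>Off the grid points the indicators of the grid intervals telescope.\<close>

lemma sum_indicator_grid: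
  assumes f: "density01 f" and n: "0 < n" and x: "\<And>i. i \<le> n \<Longrightarrow> x \<noteq> grid_point f n i"
  shows "(\<Sum>i\<in>{0..<n}. indicator {grid_point f n i..grid_point f n (i + 1)} x) = (indicator {0..1} x :: real)"
proof -
  define g :: "nat \<Rightarrow> real" where "g i = (if x \<le> grid_point f n i then 1 else 0)" for i
  have "(\<Sum>i\<in>{0..<n}. indicator {grid_point f n i..grid_point f n (i + 1)} x) = (\<Sum>i<n. g (Suc i) - g i)"
    unfolding atLeast0LessThan
  proof (rule sum.cong)
    fix i assume "i \<in> {..<n}"
    then show "indicator {grid_point f n i..grid_point f n (i + 1)} x = g (Suc i) - g i"
      using grid_point_less[OF f, of i n] x[of i] by (auto simp: g_def indicator_def)
  qed simp
  also have "\<dots> = g n - g 0" by (rule sum_lessThan_telescope)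
  also have "\<dots> = indicator {0..1} x"
    using x[of 0] n by (auto simp: g_def indicator_def grid_point_0[OF f n] grid_point_n[OF f n])
  finally show ?thesis .
qed

section \<open>Product Lebesgue measure and the strata\<close>

interpretation lborel_PiM: product_sigma_finite "\<lambda>_::nat. lborel :: real measure"
  by unfold_locales

lemma sigma_finite_leb: "sigma_finite_measure (leb d)"
  unfolding leb_def by (rule lborel_PiM.sigma_finite) simp

lemma space_leb: "space (leb d) = PiE {1..d} (\<lambda>_. UNIV)"
  by (simp add: leb_def space_PiM)

lemma sets_leb_PiE: "(\<And>m. m \<in> {1..d} \<Longrightarrow> A m \<in> sets borel) \<Longrightarrow> PiE {1..d} A \<in> sets (leb d)"
  unfolding leb_def by (intro sets_PiM_I_finite) auto

lemma emeasure_leb_box: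
  assumes "\<And>m. m \<in> {1..d} \<Longrightarrow> a m \<le> b m"
  shows "emeasure (leb d) (PiE {1..d} (\<lambda>m. {a m..b m})) = ennreal (\<Prod>m=1..d. b m - a m)"
  using assms unfolding leb_def
  by (subst lborel_PiM.emeasure_PiM) (auto intro!: prod_ennreal)

text \<open>The exceptional set is a box with one null side. It is used to discard the faces of the
  strata, which lie in finitely many coordinate hyperplanes.\<close>

lemma AE_leb_not_in_finite:
  assumes "m \<in> {1..d}" "finite F"
  shows "AE x in leb d. x m \<notin> F"
proof (rule AE_I)
  define A where "A i = (if i = m then F else UNIV)" for i
  have [measurable]: "F \<in> sets borel" using assms(2) by (intro borel_closed finite_imp_closed)
  show "{x \<in> space (leb d). \<not> x m \<notin> F} \<subseteq> PiE {1..d} A"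
    by (auto simp: A_def space_leb PiE_iff extensional_def)
  show "PiE {1..d} A \<in> sets (leb d)" by (rule sets_leb_PiE) (simp add: A_def)
  have "emeasure (leb d) (PiE {1..d} A) = (\<Prod>i=1..d. emeasure lborel (A i))"
    unfolding leb_def by (rule lborel_PiM.emeasure_PiM) (auto simp: A_def)
  \<comment> \<open>The remaining sides have infinite length, but in \<open>ennreal\<close> a single
    zero factor still makes the product vanish.\<close>
  also have "\<dots> = 0"
    using assms by (intro prod_zero) (auto simp: A_def finite_imp_null_set_lborel null_setsD1)
  finally show "emeasure (leb d) (PiE {1..d} A) = 0" .
qed

lemma indicator_PiE_eq_prod:
  assumes "finite J" "x \<in> extensional J"
  shows "indicator (PiE J A) x = (\<Prod>m\<in>J. indicator (A m) (x m) :: real)"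
  using assms by (auto simp: indicator_def PiE_iff prod_zero_iff)

text \<open>Closed strata share faces, so equality can be expected only off the grid hyperplanes.
  There it is the one-dimensional identity in each coordinate, and expanding the product of sums
  yields one term per index tuple.\<close>

lemma strata_partition:
  assumes f: "\<And>m. m \<in> {1..d} \<Longrightarrow> density01 (star l h m)"
    and p: "\<And>m. m \<in> {1..d} \<Longrightarrow> 0 < star l p m"
  shows "AE x in leb d. indicator (unit_cube d) x
    = (\<Sum>i\<in>strata_indices d l p. indicator (stratum d l h p i) x :: real)"
proof -
  have "AE x in leb d. \<forall>m\<in>{1..d}. x m \<notin> grid_point (star l h m) (star l p m) ` {..star l p m}"
    by (subst AE_finite_all) (auto intro!: AE_leb_not_in_finite)
  then show ?thesis using AE_space
  proof eventually_elim
    fix x assume x: "\<forall>m\<in>{1..d}. x m \<notin> grid_point (star l h m) (star l p m) ` {..star l p m}"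
      "x \<in> space (leb d)"
    then have ext: "x \<in> extensional {1..d}" by (auto simp: space_leb PiE_iff)
    have "indicator (unit_cube d) x = (\<Prod>m\<in>{1..d}. \<Sum>i\<in>{0..<star l p m}.
        indicator {grid_point (star l h m) (star l p m) i..grid_point (star l h m) (star l p m) (i + 1)} (x m) :: real)"
    proof -
      have "(\<Sum>i\<in>{0..<star l p m}. indicator {grid_point (star l h m) (star l p m) i..
          grid_point (star l h m) (star l p m) (i + 1)} (x m)) = (indicator {0..1} (x m) :: real)"
        if "m \<in> {1..d}" for m
        using x(1) that by (intro sum_indicator_grid f p) auto
      then show ?thesis
        unfolding unit_cube_def using ext by (subst indicator_PiE_eq_prod) auto
    qed
    also have "\<dots> = (\<Sum>i\<in>strata_indices d l p. indicator (stratum d l h p i) x)"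
      unfolding strata_indices_def stratum_def using ext
      by (subst prod_sum_PiE) (auto simp: indicator_PiE_eq_prod)
    finally show "indicator (unit_cube d) x
      = (\<Sum>i\<in>strata_indices d l p. indicator (stratum d l h p i) x :: real)" .
  qed
qed

lemma sets_stratum: "stratum d l h p i \<in> sets (leb d)"
  unfolding stratum_def by (rule sets_leb_PiE) simp

lemma sets_unit_cube: "unit_cube d \<in> sets (leb d)"
  unfolding unit_cube_def by (rule sets_leb_PiE) simp

lemma stratum_subset_unit_cube:
  assumes "\<And>m. m \<in> {1..d} \<Longrightarrow> density01 (star l h m)" and i: "i \<in> strata_indices d l p"
  shows "stratum d l h p i \<subseteq> unit_cube d"
  unfolding stratum_def unit_cube_def
proof (rule PiE_mono)
  fix m assume m: "m \<in> {1..d}"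
  then have "i m < star l p m" using i by (auto simp: strata_indices_def)
  then show "{grid_point (star l h m) (star l p m) (i m)..grid_point (star l h m) (star l p m) (i m + 1)} \<subseteq> {0..1}"
    using grid_point(1)[OF assms(1)[OF m], of "star l p m" "i m"]
      grid_point(1)[OF assms(1)[OF m], of "star l p m" "i m + 1"] by auto
qed

text \<open>Positive finite volume is what makes the uniform law on a stratum a probability measure;
  positivity comes from the strict increase of the grid points.\<close>

lemma emeasure_stratum:
  assumes "\<And>m. m \<in> {1..d} \<Longrightarrow> density01 (star l h m)" and i: "i \<in> strata_indices d l p"
  shows "emeasure (leb d) (stratum d l h p i) = ennreal (\<Prod>m=1..d.
      grid_point (star l h m) (star l p m) (i m + 1) - grid_point (star l h m) (star l p m) (i m))"
    and "0 < measure (leb d) (stratum d l h p i)"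
    and "emeasure (leb d) (stratum d l h p i) = ennreal (measure (leb d) (stratum d l h p i))"
proof -
  have less: "grid_point (star l h m) (star l p m) (i m) < grid_point (star l h m) (star l p m) (i m + 1)"
    if "m \<in> {1..d}" for m
    using i that by (intro grid_point_less assms) (auto simp: strata_indices_def)
  show *: "emeasure (leb d) (stratum d l h p i) = ennreal (\<Prod>m=1..d.
      grid_point (star l h m) (star l p m) (i m + 1) - grid_point (star l h m) (star l p m) (i m))"
    unfolding stratum_def using less by (intro emeasure_leb_box) (auto intro: less_imp_le)
  then show "emeasure (leb d) (stratum d l h p i) = ennreal (measure (leb d) (stratum d l h p i))"
    by (intro emeasure_eq_ennreal_measure) simp
  have pos: "0 < (\<Prod>m=1..d. grid_point (star l h m) (star l p m) (i m + 1) - grid_point (star l h m) (star l p m) (i m))"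
    using less by (intro prod_pos) auto
  show "0 < measure (leb d) (stratum d l h p i)"
    unfolding measure_def * using pos by simp
qed

lemma measure_stratum_le:
  assumes dec: "decomposition d k l"
    and f: "\<And>m. m \<in> {1..d} \<Longrightarrow> density01 (star l h m)"
    and c: "0 < c" "\<And>m x. m \<in> {1..d} \<Longrightarrow> x \<in> {0..1} \<Longrightarrow> c \<le> star l h m x"
    and i: "i \<in> strata_indices d l p"
  shows "measure (leb d) (stratum d l h p i) \<le> 1 / (c ^ d * real (\<Prod>j=1..k. p j ^ l j))"
proof -
  have lt: "i m < star l p m" if "m \<in> {1..d}" for m
    using i that by (auto simp: strata_indices_def)
  have less: "grid_point (star l h m) (star l p m) (i m) < grid_point (star l h m) (star l p m) (i m + 1)"
    if "m \<in> {1..d}" for m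
    using grid_point_less[OF f[OF that] lt[OF that]] .
  have "measure (leb d) (stratum d l h p i) = (\<Prod>m=1..d.
      grid_point (star l h m) (star l p m) (i m + 1) - grid_point (star l h m) (star l p m) (i m))"
    unfolding measure_def
  proof (subst emeasure_stratum(1)[OF f i])
    show "enn2real (ennreal (\<Prod>m=1..d. grid_point (star l h m) (star l p m) (i m + 1)
          - grid_point (star l h m) (star l p m) (i m)))
        = (\<Prod>m=1..d. grid_point (star l h m) (star l p m) (i m + 1)
          - grid_point (star l h m) (star l p m) (i m))"
      using less by (intro enn2real_ennreal prod_nonneg) (simp add: less_imp_le)
  qed simp
  also have "\<dots> \<le> (\<Prod>m=1..d. 1 / (c * real (star l p m)))"
    using less grid_point_gap[OF f lt c(1)] c(2) by (intro prod_mono) (auto intro: less_imp_le)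
  also have "\<dots> = 1 / (c ^ d * real (\<Prod>m=1..d. star l p m))"
    by (simp add: prod_dividef prod.distrib)
  finally show ?thesis unfolding prod_star[OF dec, of "\<lambda>x. x" p] .
qed

section \<open>Block diameters of the strata\<close>

text \<open>The Euclidean norm is at most the sum of the absolute values. This is the origin of the
  factor \<open>l j\<close> in the constants.\<close>

lemma block_norm_le:
  assumes "1 \<le> j" "\<And>i. i \<in> block l j \<Longrightarrow> \<bar>s i\<bar> \<le> b"
  shows "block_norm l j s \<le> real (l j) * b"
proof -
  have "block_norm l j s \<le> (\<Sum>i\<in>block l j. \<bar>s i\<bar>)"
    unfolding block_norm_def by (rule L2_set_le_sum_abs)
  also have "\<dots> \<le> (\<Sum>i\<in>block l j. b)" by (intro sum_mono assms)
  finally show ?thesis using assms(1) by (simp add: card_block)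
qed

lemma block_norm_stratum_le:
  assumes dec: "decomposition d k l" and j: "j \<in> {1..k}"
    and f: "\<And>m. m \<in> {1..d} \<Longrightarrow> density01 (star l h m)"
    and c: "0 < c" "\<And>m x. m \<in> {1..d} \<Longrightarrow> x \<in> {0..1} \<Longrightarrow> c \<le> star l h m x"
    and i: "i \<in> strata_indices d l p" and st: "s \<in> stratum d l h p i" "t \<in> stratum d l h p i"
  shows "block_norm l j (\<lambda>m. s m - t m) \<le> real (l j) * (1 / (c * real (p j)))"
proof (rule block_norm_le)
  fix m assume m: "m \<in> block l j"
  then have md: "m \<in> {1..d}" using decomposition_blocks[OF dec] j by blast
  have lt: "i m < star l p m" using i md by (auto simp: strata_indices_def)
  have "s m \<in> {grid_point (star l h m) (star l p m) (i m)..grid_point (star l h m) (star l p m) (i m + 1)}"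
    "t m \<in> {grid_point (star l h m) (star l p m) (i m)..grid_point (star l h m) (star l p m) (i m + 1)}"
    using st md by (auto simp: stratum_def dest: PiE_mem)
  moreover have "grid_point (star l h m) (star l p m) (i m + 1) - grid_point (star l h m) (star l p m) (i m)
      \<le> 1 / (c * real (star l p m))"
    using grid_point_gap[OF f[OF md] lt c(1)] c(2) md by blast
  ultimately show "\<bar>s m - t m\<bar> \<le> 1 / (c * real (p j))"
    using star_eq[OF m, of p] by auto
qed (use j in auto)

subsection \<open>Error bound and rate\<close>

lemma holder_increment:
  assumes "X \<in> holder_class M G d k l \<alpha> C" and s: "s \<in> unit_cube d" and t: "t \<in> unit_cube d"
  shows "integrable M (\<lambda>\<omega>. (X s \<omega> - X t \<omega>)\<^sup>2)"
    and "(\<integral>\<^sup>+\<omega>. ennreal ((X s \<omega> - X t \<omega>)\<^sup>2) \<partial>M)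
      \<le> ennreal (C * (\<Sum>j=1..k. block_norm l j (\<lambda>m. s m - t m) powr \<alpha> j))"
proof -
  have sq: "square_integrable M (X r)" if "r \<in> unit_cube d" for r
    using assms(1) that by (auto simp: holder_class_def random_field_def)
  have [measurable]: "X s \<in> borel_measurable M" "X t \<in> borel_measurable M"
    and int: "integrable M (\<lambda>\<omega>. (X s \<omega>)\<^sup>2)" "integrable M (\<lambda>\<omega>. (X t \<omega>)\<^sup>2)"
    using sq[OF s] sq[OF t] by (auto simp: square_integrable_def)
  \<comment> \<open>Integrability has to come first: \<open>rv_norm\<close> rests on the Bochner
    integral, which is 0 for a non-integrable function, so its bound says something about the
    nonnegative integral only once the square is integrable.\<close>
  show *: "integrable M (\<lambda>\<omega>. (X s \<omega> - X t \<omega>)\<^sup>2)"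
  proof (rule Bochner_Integration.integrable_bound)
    show "integrable M (\<lambda>\<omega>. 2 * (X s \<omega>)\<^sup>2 + 2 * (X t \<omega>)\<^sup>2)" using int by simp
    have "(x - y)\<^sup>2 \<le> 2 * x\<^sup>2 + 2 * y\<^sup>2" for x y :: real
      using zero_le_power2[of "x + y"] by (simp add: power2_eq_square algebra_simps)
    then show "AE \<omega> in M. norm ((X s \<omega> - X t \<omega>)\<^sup>2) \<le> norm (2 * (X s \<omega>)\<^sup>2 + 2 * (X t \<omega>)\<^sup>2)"
      by simp
  qed measurable
  \<comment> \<open>The Hoelder condition is phrased with a shift. For the shift
    \<open>s - t\<close> the restricted sum is \<open>s\<close> itself, because points of the cube
    are \<open>undefined\<close> off \<open>{1..d}\<close>.\<close>
  have eq: "(\<lambda>i\<in>{1..d}. t i + (s i - t i)) = s"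
    using s by (auto simp: unit_cube_def PiE_iff extensional_def restrict_def)
  have "(\<lambda>i\<in>{1..d}. t i + u i) \<in> unit_cube d \<Longrightarrow>
      (rv_norm M (\<lambda>\<omega>. X (\<lambda>i\<in>{1..d}. t i + u i) \<omega> - X t \<omega>))\<^sup>2
        \<le> C * (\<Sum>j=1..k. block_norm l j u powr \<alpha> j)" for u
    using assms(1) t unfolding holder_class_def by blast
  from this[of "\<lambda>i. s i - t i", unfolded eq, OF s]
  have "(rv_norm M (\<lambda>\<omega>. X s \<omega> - X t \<omega>))\<^sup>2
      \<le> C * (\<Sum>j=1..k. block_norm l j (\<lambda>m. s m - t m) powr \<alpha> j)" .
  moreover have "(rv_norm M (\<lambda>\<omega>. X s \<omega> - X t \<omega>))\<^sup>2 = (\<integral>\<omega>. (X s \<omega> - X t \<omega>)\<^sup>2 \<partial>M)"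
    by (simp add: rv_norm_def)
  ultimately show "(\<integral>\<^sup>+\<omega>. ennreal ((X s \<omega> - X t \<omega>)\<^sup>2) \<partial>M)
      \<le> ennreal (C * (\<Sum>j=1..k. block_norm l j (\<lambda>m. s m - t m) powr \<alpha> j))"
    using * by (subst nn_integral_eq_integral) (auto intro: ennreal_leI)
qed

text \<open>Every point of the cube is compared with the origin, where the second moment is finite;
  the Hoelder condition bounds the increment uniformly.\<close>

lemma holder_second_moment_bounded:
  assumes X: "X \<in> holder_class M G d k l \<alpha> C" and "0 \<le> C"
    and dec: "decomposition d k l" and \<alpha>: "\<And>j. j \<in> {1..k} \<Longrightarrow> 0 < \<alpha> j"
  obtains B where "\<And>t. t \<in> unit_cube d \<Longrightarrow> (\<integral>\<^sup>+\<omega>. ennreal ((X t \<omega>)\<^sup>2) \<partial>M) \<le> ennreal B"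
proof
  define t0 where "t0 = (\<lambda>i\<in>{1..d}. 0 :: real)"
  \<comment> \<open>Coordinates in the cube differ from 0 by at most 1, so the norm of block
    \<open>j\<close> is at most \<open>l j\<close>.\<close>
  define K where "K = C * (\<Sum>j=1..k. real (l j) powr \<alpha> j)"
  have t0: "t0 \<in> unit_cube d" by (auto simp: t0_def unit_cube_def)
  have sq: "square_integrable M (X r)" if "r \<in> unit_cube d" for r
    using X that by (auto simp: holder_class_def random_field_def)
  fix t assume t: "t \<in> unit_cube d"
  have [measurable]: "X t0 \<in> borel_measurable M" "X t \<in> borel_measurable M"
    using sq[OF t] sq[OF t0] by (auto simp: square_integrable_def)
  have K0: "0 \<le> K" using assms(2) by (auto simp: K_def intro!: mult_nonneg_nonneg sum_nonneg)
  have "block_norm l j (\<lambda>m. t m - t0 m) powr \<alpha> j \<le> real (l j) powr \<alpha> j" if j: "j \<in> {1..k}" for j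
  proof (rule powr_mono2)
    have "block_norm l j (\<lambda>m. t m - t0 m) \<le> real (l j) * 1"
    proof (rule block_norm_le)
      fix i assume "i \<in> block l j"
      then have "i \<in> {1..d}" using decomposition_blocks[OF dec] j by blast
      then show "\<bar>t i - t0 i\<bar> \<le> 1" using t by (auto simp: t0_def unit_cube_def PiE_iff)
    qed (use j in auto)
    then show "block_norm l j (\<lambda>m. t m - t0 m) \<le> real (l j)" by simp
    show "0 \<le> block_norm l j (\<lambda>m. t m - t0 m)" by (simp add: block_norm_def)
    show "0 \<le> \<alpha> j" using \<alpha>[OF j] by simp
  qed
  then have "C * (\<Sum>j=1..k. block_norm l j (\<lambda>m. t m - t0 m) powr \<alpha> j) \<le> K"
    unfolding K_def using assms(2) by (intro mult_left_mono sum_mono) auto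
  then have inc: "(\<integral>\<^sup>+\<omega>. ennreal ((X t \<omega> - X t0 \<omega>)\<^sup>2) \<partial>M) \<le> ennreal K"
    using holder_increment(2)[OF X t t0] by (meson ennreal_leI order_trans)
  have "y\<^sup>2 \<le> 2 * x\<^sup>2 + 2 * (y - x)\<^sup>2" for x y :: real
    using zero_le_power2[of "2 * x - y"] by (simp add: power2_eq_square algebra_simps)
  then have "ennreal ((X t \<omega>)\<^sup>2) \<le> 2 * ennreal ((X t0 \<omega>)\<^sup>2) + 2 * ennreal ((X t \<omega> - X t0 \<omega>)\<^sup>2)" for \<omega>
    by (simp add: ennreal_mult'[symmetric] ennreal_plus[symmetric] ennreal_leI
        flip: ennreal_numeral del: ennreal_plus)
  then have "(\<integral>\<^sup>+\<omega>. ennreal ((X t \<omega>)\<^sup>2) \<partial>M)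
      \<le> (\<integral>\<^sup>+\<omega>. 2 * ennreal ((X t0 \<omega>)\<^sup>2) + 2 * ennreal ((X t \<omega> - X t0 \<omega>)\<^sup>2) \<partial>M)"
    by (intro nn_integral_mono)
  also have "\<dots> = 2 * (\<integral>\<^sup>+\<omega>. ennreal ((X t0 \<omega>)\<^sup>2) \<partial>M)
      + 2 * (\<integral>\<^sup>+\<omega>. ennreal ((X t \<omega> - X t0 \<omega>)\<^sup>2) \<partial>M)"
    by (simp add: nn_integral_add nn_integral_cmult)
  also have "\<dots> \<le> 2 * ennreal (\<integral>\<omega>. (X t0 \<omega>)\<^sup>2 \<partial>M) + 2 * ennreal K"
    using inc sq[OF t0] by (intro add_mono mult_left_mono)
      (auto simp: square_integrable_def nn_integral_eq_integral)
  also have "\<dots> = ennreal (2 * (\<integral>\<omega>. (X t0 \<omega>)\<^sup>2 \<partial>M) + 2 * K)"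
    using K0 by (simp add: ennreal_mult' ennreal_plus)
  finally show "(\<integral>\<^sup>+\<omega>. ennreal ((X t \<omega>)\<^sup>2) \<partial>M) \<le> ennreal (2 * (\<integral>\<omega>. (X t0 \<omega>)\<^sup>2 \<partial>M) + 2 * K)" .
qed

text \<open>Extending the field by zero avoids working on the restricted space of \<open>random_field\<close>.\<close>

lemma random_field_zero_extension_measurable:
  assumes "random_field M G d X"
  shows "(\<lambda>(t, \<omega>). if t \<in> unit_cube d then X t \<omega> else 0) \<in> borel_measurable (leb d \<Otimes>\<^sub>M G)"
proof -
  define S where "S = {z \<in> space (leb d \<Otimes>\<^sub>M G). fst z \<in> unit_cube d}"
  have [measurable]: "unit_cube d \<in> sets (leb d)" by (rule sets_unit_cube)
  have S: "S \<in> sets (leb d \<Otimes>\<^sub>M G)" unfolding S_def by measurable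
  have X: "(\<lambda>(t, \<omega>). X t \<omega>) \<in> borel_measurable (restrict_space (leb d) (unit_cube d) \<Otimes>\<^sub>M G)"
    using assms by (simp add: random_field_def)
  have "(\<lambda>z. (fst z, snd z)) \<in> measurable (restrict_space (leb d \<Otimes>\<^sub>M G) S)
      (restrict_space (leb d) (unit_cube d) \<Otimes>\<^sub>M G)"
    by (intro measurable_Pair measurable_restrict_space2 measurable_restrict_space1)
      (auto simp: space_restrict_space S_def)
  from measurable_compose[OF this X]
  have "(\<lambda>z. X (fst z) (snd z)) \<in> borel_measurable (restrict_space (leb d \<Otimes>\<^sub>M G) S)"
    by (simp add: case_prod_beta)
  then have "(\<lambda>z. if z \<in> S then X (fst z) (snd z) else 0) \<in> borel_measurable (leb d \<Otimes>\<^sub>M G)"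
    using S by (subst (asm) measurable_restrict_space_iff) auto
  then show ?thesis
    by (rule measurable_cong[THEN iffD1, rotated]) (auto simp: S_def)
qed

lemma cRS_lower_bound:
  assumes "cRS k l h S n"
  obtains c where "0 < c" "\<And>j x. j \<in> {1..k} \<Longrightarrow> x \<in> {0..1} \<Longrightarrow> c \<le> h j x"
proof -
  have "\<forall>j\<in>{1..k}. \<exists>c>0. \<forall>x\<in>{0..1}. c \<le> h j x"
    using assms density01_lower_bound unfolding cRS_def by metis
  then obtain b where b: "\<And>j. j \<in> {1..k} \<Longrightarrow> 0 < b j"
    "\<And>j x. j \<in> {1..k} \<Longrightarrow> x \<in> {0..1} \<Longrightarrow> b j \<le> h j x" by metis
  \<comment> \<open>The inserted 1 keeps the minimum over a nonempty set even for
    \<open>k = 0\<close>.\<close>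
  define c where "c = Min (insert 1 (b ` {1..k}))"
  have "0 < c" "\<And>j. j \<in> {1..k} \<Longrightarrow> c \<le> b j"
    unfolding c_def using b(1) by (subst Min_gr_iff) (auto simp del: Min_insert intro!: Min_le)
  then show thesis using that b(2) order_trans by metis
qed

text \<open>There are \<open>N\<close> strata, each of volume at most \<open>1 / (c ^ d * N)\<close>, which gives the factor
  \<open>1 / N\<close> without using that the volumes sum to one.\<close>

lemma stratified_quadrature_error:
  assumes "prob_space M" and dec: "decomposition d k l"
    and \<alpha>: "\<And>j. j \<in> {1..k} \<Longrightarrow> 0 < \<alpha> j" and C: "0 < C"
    and X: "X \<in> holder_class M G d k l \<alpha> C"
    and h: "\<And>j. j \<in> {1..k} \<Longrightarrow> density01 (h j)"
    and c: "0 < c" "\<And>j x. j \<in> {1..k} \<Longrightarrow> x \<in> {0..1} \<Longrightarrow> c \<le> h j x"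
    and p: "\<And>j. j \<in> {1..k} \<Longrightarrow> 0 < p j" "(\<Prod>j=1..k. p j ^ l j) = N"
    and \<eta>: "stratified_points M G d l h p \<eta>"
  defines "err \<equiv> \<lambda>\<omega>. field_integral d X \<omega> - quadrature d l h p \<eta> X \<omega>"
  shows "square_integrable M err"
    and "(rv_norm M err)\<^sup>2 \<le> C / real N *
      (\<Sum>j=1..k. ((1 / c ^ d)\<^sup>2 * (real (l j) / c) powr \<alpha> j) / real (p j) powr \<alpha> j)"
proof -
  interpret prob_space M by fact
  define I where "I = strata_indices d l p"
  define A where "A = stratum d l h p"
  define Y where "Y t \<omega> = (if t \<in> unit_cube d then X t \<omega> else 0)" for t \<omega>
  define H where "H = C * (\<Sum>j=1..k. (real (l j) * (1 / (c * real (p j)))) powr \<alpha> j)"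
  have N: "0 < N" unfolding p(2)[symmetric] using p(1) by (intro prod_pos) auto
  have H0: "0 \<le> H" using C by (auto simp: H_def intro!: mult_nonneg_nonneg sum_nonneg)
  have star: "\<exists>j\<in>{1..k}. \<forall>a::nat \<Rightarrow> nat. star l a m = a j" "\<exists>j\<in>{1..k}. star l h m = h j"
    if m: "m \<in> {1..d}" for m
    using m star_eq[of m l] unfolding decomposition_blocks[OF dec] by blast+
  have hs: "density01 (star l h m)" and ps: "0 < star l p m"
    and cs: "\<And>x. x \<in> {0..1} \<Longrightarrow> c \<le> star l h m x" if m: "m \<in> {1..d}" for m
    using star[OF m] h p(1) c(2) by metis+
  have "finite I" unfolding I_def strata_indices_def by (intro finite_PiE) auto
  have cardI: "card I = N"
    unfolding I_def strata_indices_def p(2)[symmetric]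
    using prod_star[OF dec, of "\<lambda>x. x" p] by (simp add: card_PiE)
  have sub: "subalgebra M G" and rf: "random_field M G d X"
    using X by (auto simp: holder_class_def random_field_def)
  have Ycube: "A i \<subseteq> unit_cube d" if "i \<in> I" for i
    using stratum_subset_unit_cube[OF hs] that by (auto simp: I_def A_def)
  obtain B where B: "\<And>t. t \<in> unit_cube d \<Longrightarrow> (\<integral>\<^sup>+\<omega>. ennreal ((X t \<omega>)\<^sup>2) \<partial>M) \<le> ennreal B"
    using holder_second_moment_bounded[OF X _ dec \<alpha>] C by (metis less_imp_le)
  have \<eta>': "\<And>i. i \<in> I \<Longrightarrow> distr M (leb d) (\<eta> i) = uniform_measure (leb d) (A i)"
    "\<And>i. i \<in> I \<Longrightarrow> \<eta> i \<in> measurable M (restrict_space (leb d) (A i))"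
    "indep_vars (\<lambda>_. leb d) \<eta> I"
    "indep_set (sets G) (sets (vimage_algebra (space M) (\<lambda>\<omega>. \<lambda>i\<in>I. \<eta> i \<omega>) (PiM I (\<lambda>_. leb d))))"
    using \<eta> unfolding stratified_points_def uniform_on_def I_def A_def by auto
  have em: "emeasure (leb d) (A i) \<noteq> 0" "emeasure (leb d) (A i) \<noteq> \<infinity>" if "i \<in> I" for i
    using emeasure_stratum(2,3)[OF hs, where d=d and i=i and p=p] that by (auto simp: I_def A_def)
  have Hbound: "(\<integral>\<^sup>+\<omega>. ennreal ((Y s \<omega> - Y t \<omega>)\<^sup>2) \<partial>M) \<le> ennreal H"
    if i: "i \<in> I" and st: "s \<in> A i" "t \<in> A i" for i s t
  proof -
    have cube: "s \<in> unit_cube d" "t \<in> unit_cube d" using Ycube[OF i] st by auto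
    have "C * (\<Sum>j=1..k. block_norm l j (\<lambda>m. s m - t m) powr \<alpha> j) \<le> H"
      unfolding H_def
    proof (intro mult_left_mono sum_mono powr_mono2)
      fix j assume j: "j \<in> {1..k}"
      show "0 \<le> \<alpha> j" using \<alpha>[OF j] by simp
      show "0 \<le> block_norm l j (\<lambda>m. s m - t m)" by (simp add: block_norm_def)
      show "block_norm l j (\<lambda>m. s m - t m) \<le> real (l j) * (1 / (c * real (p j)))"
        using block_norm_stratum_le[OF dec j hs c(1) cs] i st by (auto simp: I_def A_def)
    qed (use C in simp)
    then show ?thesis
      using holder_increment(2)[OF X cube] cube by (simp add: Y_def order_trans[OF _ ennreal_leI])
  qed
  have core: "(\<lambda>\<omega>. (LINT t:unit_cube d|leb d. Y t \<omega>) - (\<Sum>i\<in>I. Y (\<eta> i \<omega>) \<omega> * measure (leb d) (A i)))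
      \<in> borel_measurable M"
    "(\<integral>\<^sup>+\<omega>. ennreal (((LINT t:unit_cube d|leb d. Y t \<omega>)
        - (\<Sum>i\<in>I. Y (\<eta> i \<omega>) \<omega> * measure (leb d) (A i)))\<^sup>2) \<partial>M)
      \<le> (\<Sum>i\<in>I. ennreal ((measure (leb d) (A i))\<^sup>2) * ennreal H)"
  proof -
    have part: "AE x in leb d. indicator (unit_cube d) x = (\<Sum>i\<in>I. indicator (A i) x :: real)"
      using strata_partition[OF hs ps] unfolding I_def A_def by blast
    have setsA: "A i \<in> sets (leb d)" for i unfolding A_def by (rule sets_stratum)
    have Ymeas: "(\<lambda>(t, \<omega>). Y t \<omega>) \<in> borel_measurable (leb d \<Otimes>\<^sub>M G)"
      unfolding Y_def by (rule random_field_zero_extension_measurable[OF rf])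
    have YB: "(\<integral>\<^sup>+\<omega>. ennreal ((Y t \<omega>)\<^sup>2) \<partial>M) \<le> ennreal B" if "i \<in> I" "t \<in> A i" for i t
      using B[of t] Ycube[OF that(1)] that(2) by (auto simp: Y_def subset_iff)
    note * = stratified_error_second_moment[OF sigma_finite_leb sub \<open>finite I\<close> setsA em part
        sets_unit_cube \<eta>'(1,3,4) Ymeas YB Hbound]
    show "(\<lambda>\<omega>. (LINT t:unit_cube d|leb d. Y t \<omega>) - (\<Sum>i\<in>I. Y (\<eta> i \<omega>) \<omega> * measure (leb d) (A i)))
        \<in> borel_measurable M"
      by (rule *(1))
    show "(\<integral>\<^sup>+\<omega>. ennreal (((LINT t:unit_cube d|leb d. Y t \<omega>)
        - (\<Sum>i\<in>I. Y (\<eta> i \<omega>) \<omega> * measure (leb d) (A i)))\<^sup>2) \<partial>M)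
      \<le> (\<Sum>i\<in>I. ennreal ((measure (leb d) (A i))\<^sup>2) * ennreal H)"
      by (rule *(2))
  qed
  \<comment> \<open>\<open>\<eta> i\<close> maps all of the sample space into its stratum, hence
    into the cube, so replacing \<open>X\<close> by its extension changes nothing at the sampled
    points. Outside \<open>space M\<close> nothing is known about \<open>\<eta> i\<close>.\<close>
  have err_eq: "err \<omega> = (LINT t:unit_cube d|leb d. Y t \<omega>) - (\<Sum>i\<in>I. Y (\<eta> i \<omega>) \<omega> * measure (leb d) (A i))"
    if \<omega>: "\<omega> \<in> space M" for \<omega>
  proof -
    have "\<eta> i \<omega> \<in> unit_cube d" if "i \<in> I" for i
      using measurable_space[OF \<eta>'(2)[OF that] \<omega>] Ycube[OF that] by (auto simp: space_restrict_space)
    then have "quadrature d l h p \<eta> X \<omega> = (\<Sum>i\<in>I. Y (\<eta> i \<omega>) \<omega> * measure (leb d) (A i))"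
      unfolding quadrature_def I_def[symmetric] A_def[symmetric] Y_def by (intro sum.cong) auto
    moreover have "field_integral d X \<omega> = (LINT t:unit_cube d|leb d. Y t \<omega>)"
      unfolding field_integral_def Y_def set_lebesgue_integral_def
      by (intro Bochner_Integration.integral_cong) (auto simp: indicator_def)
    ultimately show ?thesis by (simp add: err_def)
  qed
  have meas: "err \<in> borel_measurable M"
    using core(1) by (rule measurable_cong[THEN iffD2, rotated]) (rule err_eq)
  \<comment> \<open>Squaring the volume bound gives the factor \<open>(1 / c ^ d)\<^sup>2\<close>;
    the block diameter \<open>l j / (c * p j)\<close> raised to the power \<open>\<alpha> j\<close>
    gives the rest, with the dependence on \<open>p j\<close> separated out.\<close>
  define R where "R = C / real N *
      (\<Sum>j=1..k. ((1 / c ^ d)\<^sup>2 * (real (l j) / c) powr \<alpha> j) / real (p j) powr \<alpha> j)"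
  have "(\<integral>\<^sup>+\<omega>. ennreal ((err \<omega>)\<^sup>2) \<partial>M) \<le> (\<Sum>i\<in>I. ennreal ((measure (leb d) (A i))\<^sup>2) * ennreal H)"
    using core(2) by (subst nn_integral_cong[where v="\<lambda>\<omega>. ennreal (((LINT t:unit_cube d|leb d. Y t \<omega>)
        - (\<Sum>i\<in>I. Y (\<eta> i \<omega>) \<omega> * measure (leb d) (A i)))\<^sup>2)"]) (auto simp: err_eq)
  also have "\<dots> = ennreal (\<Sum>i\<in>I. (measure (leb d) (A i))\<^sup>2 * H)"
    using H0 by (subst sum_ennreal[symmetric]) (auto simp: ennreal_mult)
  also have "\<dots> \<le> ennreal R"
  proof (rule ennreal_leI)
    have "(\<Sum>i\<in>I. (measure (leb d) (A i))\<^sup>2 * H) \<le> (\<Sum>i\<in>I. (1 / (c ^ d * real N))\<^sup>2 * H)"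
      using measure_stratum_le[OF dec hs c(1) cs, where p=p] H0 unfolding p(2) I_def A_def
      by (intro sum_mono mult_right_mono power_mono) auto
    also have "\<dots> = (1 / c ^ d)\<^sup>2 * H / real N"
      using N by (simp add: cardI power2_eq_square)
    also have "\<dots> = R"
    proof -
      have "(real (l j) * (1 / (c * real (p j)))) powr \<alpha> j = (real (l j) / c) powr \<alpha> j / real (p j) powr \<alpha> j"
        for j
        using c(1) by (subst powr_divide[symmetric]) auto
      then show ?thesis
        unfolding R_def H_def by (simp add: sum_distrib_left sum_divide_distrib mult_ac)
    qed
    finally show "(\<Sum>i\<in>I. (measure (leb d) (A i))\<^sup>2 * H) \<le> R" .
  qed
  finally have le: "(\<integral>\<^sup>+\<omega>. ennreal ((err \<omega>)\<^sup>2) \<partial>M) \<le> ennreal R" .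
  have int: "integrable M (\<lambda>\<omega>. (err \<omega>)\<^sup>2)"
    using meas le by (intro integrableI_nonneg) (auto intro: le_less_trans)
  then show "square_integrable M err" using meas by (simp add: square_integrable_def)
  \<comment> \<open>\<open>ennreal\<close> sends negative numbers to 0, so the sign of
    \<open>R\<close> matters when the bound is carried back to the reals.\<close>
  have "0 \<le> R" unfolding R_def using C c(1) by (intro mult_nonneg_nonneg sum_nonneg) auto
  then show "(rv_norm M err)\<^sup>2 \<le> C / real N *
      (\<Sum>j=1..k. ((1 / c ^ d)\<^sup>2 * (real (l j) / c) powr \<alpha> j) / real (p j) powr \<alpha> j)"
    using le int unfolding R_def[symmetric] rv_norm_def
    by (simp add: nn_integral_eq_integral)
qed

section \<open>Rate under the balanced allocation\<close>

text \<open>The exponents are chosen so that \<open>n N j powr \<alpha> j\<close> is asymptotic to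
  \<open>N powr \<rho>\<close> for every \<open>j\<close>: all blocks contribute at the same order,
  and the prefactor supplies the additional power of \<open>N\<close>.\<close>

lemma optimal_allocation_rate:
  fixes n :: "nat \<Rightarrow> nat \<Rightarrow> nat" and e :: "nat \<Rightarrow> real"
  assumes F: "F = at_top_in S" and S: "\<And>N. N \<in> S \<Longrightarrow> 0 < N"
    and \<alpha>: "\<And>j. j \<in> {1..k} \<Longrightarrow> 0 < \<alpha> j"
    and n: "\<And>j. j \<in> {1..k} \<Longrightarrow> (\<lambda>N. real (n N j)) \<sim>[F] (\<lambda>N. real N powr (\<rho> / \<alpha> j))"
    and e: "\<And>N. N \<in> S \<Longrightarrow> 0 \<le> e N" "\<And>N. N \<in> S \<Longrightarrow> e N \<le> K / real N * (\<Sum>j=1..k. c j / real (n N j) powr \<alpha> j)"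
  shows "e \<in> O[F](\<lambda>N. real N powr (- (1 + \<rho>)))"
proof -
  \<comment> \<open>The filter lives on the admissible sample sizes, so the estimates are required
    only for \<open>N\<close> in \<open>S\<close>.\<close>
  have inS: "\<forall>\<^sub>F N in F. N \<in> S"
    unfolding F at_top_in_def eventually_inf_principal by simp
  have "(\<lambda>N. c j / real (n N j) powr \<alpha> j) \<in> O[F](\<lambda>N. real N powr (- \<rho>))" if j: "j \<in> {1..k}" for j
  proof -
    have "(\<lambda>N. real (n N j) powr \<alpha> j) \<sim>[F] (\<lambda>N. (real N powr (\<rho> / \<alpha> j)) powr \<alpha> j)"
      by (rule asymp_equiv_powr_real[OF n[OF j]]) auto
    moreover have "(\<lambda>N. (real N powr (\<rho> / \<alpha> j)) powr \<alpha> j) = (\<lambda>N. real N powr \<rho>)"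
      using \<alpha>[OF j] by (simp add: powr_powr)
    ultimately have "(\<lambda>N. inverse (real (n N j) powr \<alpha> j)) \<sim>[F] (\<lambda>N. inverse (real N powr \<rho>))"
      by (auto intro: asymp_equiv_inverse)
    then have "(\<lambda>N. inverse (real (n N j) powr \<alpha> j)) \<in> O[F](\<lambda>N. real N powr (- \<rho>))"
      by (simp add: asymp_equiv_imp_bigo powr_minus)
    then have "(\<lambda>N. c j * inverse (real (n N j) powr \<alpha> j)) \<in> O[F](\<lambda>N. real N powr (- \<rho>))"
      by (cases "c j = 0") simp_all
    then show ?thesis by (simp add: divide_inverse)
  qed
  then have sum: "(\<lambda>N. \<Sum>j=1..k. c j / real (n N j) powr \<alpha> j) \<in> O[F](\<lambda>N. real N powr (- \<rho>))"
    by (rule big_sum_in_bigo)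
  have "(\<lambda>N. K / real N) \<in> O[F](\<lambda>N. inverse (real N))"
    by (simp add: divide_inverse)
  from landau_o.big.mult[OF this sum]
  have "(\<lambda>N. K / real N * (\<Sum>j=1..k. c j / real (n N j) powr \<alpha> j))
      \<in> O[F](\<lambda>N. inverse (real N) * real N powr (- \<rho>))" .
  also have "(\<lambda>N. inverse (real N) * real N powr (- \<rho>)) \<in> \<Theta>[F](\<lambda>N. real N powr (- (1 + \<rho>)))"
  proof (rule bigthetaI_cong, use inS in eventually_elim)
    fix N assume "N \<in> S"
    then show "inverse (real N) * real N powr (- \<rho>) = real N powr (- (1 + \<rho>))"
      using S powr_add[of "real N" "-1" "- \<rho>"] by (simp add: powr_minus)
  qed
  finally have "(\<lambda>N. K / real N * (\<Sum>j=1..k. c j / real (n N j) powr \<alpha> j))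
      \<in> O[F](\<lambda>N. real N powr (- (1 + \<rho>)))" .
  moreover have "e \<in> O[F](\<lambda>N. K / real N * (\<Sum>j=1..k. c j / real (n N j) powr \<alpha> j))"
  proof (rule bigoI[where c=1], use inS in eventually_elim)
    fix N assume "N \<in> S"
    from e[OF this] show "norm (e N) \<le> 1 * norm (K / real N * (\<Sum>j=1..k. c j / real (n N j) powr \<alpha> j))"
      by (simp only: real_norm_def)
  qed
  ultimately show ?thesis by (rule landau_o.big_trans[rotated])
qed

text \<open>Square integrability of the error is part of the claim because otherwise
  \<open>rv_norm\<close> could be 0 by default and the bounds would be void. The value of
  \<open>\<rho>\<close> fits the design: the numbers \<open>l j * \<rho> / \<alpha> j\<close> sum to
  1, in accordance with the product of the \<open>n N j ^ l j\<close> being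
  \<open>N\<close>.\<close>

theorem proposition2:
  fixes M G :: "'a measure"
    and d k :: nat
    and l :: "nat \<Rightarrow> nat"
    and \<alpha> :: "nat \<Rightarrow> real"
    and C :: real
    and X :: "(nat \<Rightarrow> real) \<Rightarrow> 'a \<Rightarrow> real"
    and h :: "nat \<Rightarrow> real \<Rightarrow> real"
    and S :: "nat set"
    and n :: "nat \<Rightarrow> nat \<Rightarrow> nat"
    and \<eta> :: "nat \<Rightarrow> (nat \<Rightarrow> nat) \<Rightarrow> 'a \<Rightarrow> nat \<Rightarrow> real"
  assumes "prob_space M"
    and "1 \<le> d"
    and "decomposition d k l"
    and "\<forall>j\<in>{1..k}. 0 < \<alpha> j \<and> \<alpha> j < 2"
    and "0 < C"
    and "X \<in> holder_class M G d k l \<alpha> C"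
    and "cRS k l h S n"
    and "\<forall>N\<in>S. stratified_points M G d l h (n N) (\<eta> N)"
  defines "err \<equiv> \<lambda>N \<omega>. field_integral d X \<omega> - quadrature d l h (n N) (\<eta> N) X \<omega>"
    and "\<rho> \<equiv> rate_exponent k l \<alpha>"
  shows "(\<forall>N\<in>S. square_integrable M (err N)) \<and>
    (\<exists>c :: nat \<Rightarrow> real. (\<forall>j\<in>{1..k}. 0 < c j) \<and>
       (\<forall>N\<in>S. (rv_norm M (err N))\<^sup>2
          \<le> C / real N * (\<Sum>j=1..k. c j / real (n N j) powr \<alpha> j))) \<and>
    ((\<forall>j\<in>{1..k}. (\<lambda>N. real (n N j)) \<sim>[at_top_in S] (\<lambda>N. real N powr (\<rho> / \<alpha> j))) \<longrightarrow>
       (\<lambda>N. (rv_norm M (err N))\<^sup>2) \<in> O[at_top_in S](\<lambda>N. real N powr (- (1 + \<rho>))))"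
proof -
  have \<alpha>: "\<And>j. j \<in> {1..k} \<Longrightarrow> 0 < \<alpha> j" using assms(4) by blast
  have h: "\<And>j. j \<in> {1..k} \<Longrightarrow> density01 (h j)"
    and S: "\<And>N. N \<in> S \<Longrightarrow> 0 < N"
    and n: "\<And>N j. N \<in> S \<Longrightarrow> j \<in> {1..k} \<Longrightarrow> 0 < n N j"
    "\<And>N. N \<in> S \<Longrightarrow> (\<Prod>j=1..k. n N j ^ l j) = N"
    using assms(7) by (auto simp: cRS_def)
  obtain b where b: "0 < b" "\<And>j x. j \<in> {1..k} \<Longrightarrow> x \<in> {0..1} \<Longrightarrow> b \<le> h j x"
    using cRS_lower_bound[OF assms(7)] by blast
  \<comment> \<open>The bound \<open>b\<close> comes from the densities alone, so these constants do
    not depend on \<open>N\<close>. They are positive because every \<open>l j\<close> is; a zero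
    base would make \<open>powr\<close> vanish.\<close>
  define c where "c j = (1 / b ^ d)\<^sup>2 * (real (l j) / b) powr \<alpha> j" for j
  have c: "0 < c j" if "j \<in> {1..k}" for j
    using assms(3) b(1) that unfolding c_def decomposition_def by (auto intro!: mult_pos_pos)
  have err: "square_integrable M (err N)"
    "(rv_norm M (err N))\<^sup>2 \<le> C / real N * (\<Sum>j=1..k. c j / real (n N j) powr \<alpha> j)" if "N \<in> S" for N
    unfolding err_def c_def using stratified_quadrature_error[OF assms(1,3) \<alpha> assms(5,6) h b n[OF that]
        assms(8)[rule_format, OF that]] by blast+
  have "(\<lambda>N. (rv_norm M (err N))\<^sup>2) \<in> O[at_top_in S](\<lambda>N. real N powr (- (1 + \<rho>)))"
    if "\<forall>j\<in>{1..k}. (\<lambda>N. real (n N j)) \<sim>[at_top_in S] (\<lambda>N. real N powr (\<rho> / \<alpha> j))"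
    using that by (intro optimal_allocation_rate[OF refl S \<alpha> _ _ err(2)]) auto
  then show ?thesis using err c by blast
qed

end
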